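(* Let $X$ be a formal vector field on $\mathbb{C}^n$ vanishing at the origin, and assume $X$ is in Poincaré–Dulac normal form with diagonal semisimple part $X^s=\sum_{i=1}^n\gamma_i x_i\,\partial/\partial x_i$. Write $X^s=\sum_{k=1}^{\tau}\rho_k Z_k$ where $\tau$ is the toric degree, $\rho_1,\dots,\rho_\tau\in\mathbb{C}$ are incommensurable and $Z_k=\sum_{j=1}^n a_{kj}x_j\,\partial/\partial x_j$ with $a_{kj}\in\mathbb{Z}$. Let $\Lambda$ be a formal rational tensor field on $\mathbb{C}^n$. Then: (i) if $\mathcal{L}_X\Lambda=0$, then $\mathcal{L}_{Z_k}\Lambda=0$ for every $k=1,\dots,\tau$; (ii) if $\mathcal{L}_X\Lambda=g\Lambda$ for some formal function $g$, then for every $k=1,\dots,\tau$ there is a formal function $g_k$ with $\mathcal{L}_{Z_k}\Lambda=g_k\Lambda$.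
   Context: For a formal vector field $X$ vanishing at $0$, let $X^{(1)}=X^s+X^n$ be the Jordan decomposition of its linear part into semisimple and nilpotent parts; $X$ is in Poincaré–Dulac normal form if $[X^s,X]=0$. When $X^s=\sum\gamma_i x_i\partial/\partial x_i$ is diagonal, the toric degree $\tau$ is the smallest integer such that $X^s=\sum_{k=1}^\tau\rho_kZ_k$ with $\rho_k\in\mathbb{C}$ and $Z_k=\sum_j a_{kj}x_j\partial/\partial x_j$, $a_{kj}\in\mathbb{Z}$; minimality is equivalent to $\rho_1,\dots,\rho_\tau$ being incommensurable (linearly independent over $\mathbb{Q}$). The vector fields $\sqrt{-1}Z_k$ generate the associated torus action of $X$. A formal rational tensor field is a quotient $\Lambda=\Omega/f$ of a formal tensor field $\Omega$ by a nontrivial formal function $f$; Lie derivatives are computed by the quotient rule. *)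

theory Defs
  imports Complex_Main
begin

text \<open>A formal power series is its coefficient function on multi-indices.\<close>
type_synonym 'n mps = "('n \<Rightarrow> nat) \<Rightarrow> complex"

definition mps_zero :: "'n mps" where
  "mps_zero = (\<lambda>_. 0)"

definition mps_const :: "complex \<Rightarrow> 'n mps" where
  "mps_const c = (\<lambda>\<alpha>. if \<alpha> = (\<lambda>_. 0) then c else 0)"

definition mps_var :: "'n \<Rightarrow> 'n mps" where
  "mps_var i = (\<lambda>\<alpha>. if \<alpha> = (\<lambda>k. if k = i then 1 else 0) then 1 else 0)"

definition mps_add :: "'n mps \<Rightarrow> 'n mps \<Rightarrow> 'n mps" where
  "mps_add f g = (\<lambda>\<alpha>. f \<alpha> + g \<alpha>)"

definition mps_sub :: "'n mps \<Rightarrow> 'n mps \<Rightarrow> 'n mps" where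
  "mps_sub f g = (\<lambda>\<alpha>. f \<alpha> - g \<alpha>)"

text \<open>Cauchy product (the set of \<beta> \<le> \<alpha> is finite since 'n is finite).\<close>
definition mps_mult :: "'n::finite mps \<Rightarrow> 'n mps \<Rightarrow> 'n mps" where
  "mps_mult f g = (\<lambda>\<alpha>. \<Sum>\<beta>\<in>{\<beta>. \<forall>i. \<beta> i \<le> \<alpha> i}. f \<beta> * g (\<lambda>i. \<alpha> i - \<beta> i))"

definition mps_deriv :: "'n \<Rightarrow> 'n mps \<Rightarrow> 'n mps" where
  "mps_deriv i f = (\<lambda>\<alpha>. of_nat (\<alpha> i + 1) * f (\<alpha>(i := \<alpha> i + 1)))"

text \<open>A formal vector field X = sum_i X_i d/dx_i is given by its components.\<close>
type_synonym 'n vf = "'n \<Rightarrow> 'n mps"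

definition vf_apply :: "'n::finite vf \<Rightarrow> 'n mps \<Rightarrow> 'n mps" where
  "vf_apply X f = (\<lambda>\<alpha>. \<Sum>k\<in>UNIV. mps_mult (X k) (mps_deriv k f) \<alpha>)"

definition lie_bracket :: "'n::finite vf \<Rightarrow> 'n vf \<Rightarrow> 'n vf" where
  "lie_bracket Y X = (\<lambda>i. mps_sub (vf_apply Y (X i)) (vf_apply X (Y i)))"

definition diag_vf :: "('n \<Rightarrow> complex) \<Rightarrow> 'n vf" where
  "diag_vf c = (\<lambda>i \<alpha>. c i * mps_var i \<alpha>)"

definition vanishes_at_0 :: "'n vf \<Rightarrow> bool" where
  "vanishes_at_0 X \<longleftrightarrow> (\<forall>i. X i (\<lambda>_. 0) = 0)"

definition linear_part :: "'n vf \<Rightarrow> 'n \<Rightarrow> 'n \<Rightarrow> complex" where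
  "linear_part X = (\<lambda>i j. X i (\<lambda>k. if k = j then 1 else 0))"

definition mat_mult :: "('n::finite \<Rightarrow> 'n \<Rightarrow> complex) \<Rightarrow> ('n \<Rightarrow> 'n \<Rightarrow> complex) \<Rightarrow> 'n \<Rightarrow> 'n \<Rightarrow> complex" where
  "mat_mult A B = (\<lambda>i j. \<Sum>k\<in>UNIV. A i k * B k j)"

definition mat_id :: "'n \<Rightarrow> 'n \<Rightarrow> complex" where
  "mat_id = (\<lambda>i j. if i = j then 1 else 0)"

definition diag_mat :: "('n \<Rightarrow> complex) \<Rightarrow> 'n \<Rightarrow> 'n \<Rightarrow> complex" where
  "diag_mat c = (\<lambda>i j. if i = j then c i else 0)"

definition mat_nilpotent :: "('n::finite \<Rightarrow> 'n \<Rightarrow> complex) \<Rightarrow> bool" where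
  "mat_nilpotent N \<longleftrightarrow> (\<exists>m. (mat_mult N ^^ m) mat_id = (\<lambda>_ _. 0))"

text \<open>X^s = sum_i gamma_i x_i d/dx_i: the semisimple part of the Jordan decomposition
  of the linear part is diag(gamma). (The Jordan decomposition is unique, and a
  diagonal matrix is semisimple, so this characterizes the semisimple part.)\<close>
definition semisimple_part_is_diag :: "'n::finite vf \<Rightarrow> ('n \<Rightarrow> complex) \<Rightarrow> bool" where
  "semisimple_part_is_diag X \<gamma> \<longleftrightarrow>
     (\<exists>N. linear_part X = (\<lambda>i j. diag_mat \<gamma> i j + N i j)
        \<and> mat_nilpotent N
        \<and> mat_mult (diag_mat \<gamma>) N = mat_mult N (diag_mat \<gamma>))"

definition PD_normal_form :: "'n::finite vf \<Rightarrow> ('n \<Rightarrow> complex) \<Rightarrow> bool" where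
  "PD_normal_form X \<gamma> \<longleftrightarrow> lie_bracket (diag_vf \<gamma>) X = (\<lambda>_. mps_zero)"

definition incommensurable :: "nat \<Rightarrow> (nat \<Rightarrow> complex) \<Rightarrow> bool" where
  "incommensurable \<tau> \<rho> \<longleftrightarrow>
     (\<forall>r :: nat \<Rightarrow> rat. (\<Sum>k<\<tau>. of_rat (r k) * \<rho> k) = 0 \<longrightarrow> (\<forall>k<\<tau>. r k = 0))"

definition Zfield :: "(nat \<Rightarrow> 'n \<Rightarrow> int) \<Rightarrow> nat \<Rightarrow> 'n vf" where
  "Zfield a k = diag_vf (\<lambda>j. of_int (a k j))"

text \<open>Components T^{u_1..u_p}_{l_1..l_q} indexed by lists us (length p) and ls (length q);
  values at other list lengths are irrelevant.\<close>
type_synonym 'n tensor = "'n list \<Rightarrow> 'n list \<Rightarrow> 'n mps"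

definition tensor_eq :: "nat \<Rightarrow> nat \<Rightarrow> 'n tensor \<Rightarrow> 'n tensor \<Rightarrow> bool" where
  "tensor_eq p q T S \<longleftrightarrow> (\<forall>us ls. length us = p \<longrightarrow> length ls = q \<longrightarrow> T us ls = S us ls)"

definition lie_tensor :: "nat \<Rightarrow> nat \<Rightarrow> 'n::finite vf \<Rightarrow> 'n tensor \<Rightarrow> 'n tensor" where
  "lie_tensor p q X T = (\<lambda>us ls \<alpha>.
      vf_apply X (T us ls) \<alpha>
      - (\<Sum>a<p. \<Sum>k\<in>UNIV. mps_mult (mps_deriv k (X (us ! a))) (T (us[a := k]) ls) \<alpha>)
      + (\<Sum>b<q. \<Sum>k\<in>UNIV. mps_mult (mps_deriv (ls ! b) (X k)) (T us (ls[b := k])) \<alpha>))"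

type_synonym 'n rtensor = "'n tensor \<times> 'n mps"

definition rat_nontrivial :: "'n rtensor \<Rightarrow> bool" where
  "rat_nontrivial \<Lambda> \<longleftrightarrow> snd \<Lambda> \<noteq> mps_zero"

text \<open>Omega1/f1 = Omega2/f2 iff f2 Omega1 = f1 Omega2.\<close>
definition rat_eq :: "nat \<Rightarrow> nat \<Rightarrow> 'n::finite rtensor \<Rightarrow> 'n rtensor \<Rightarrow> bool" where
  "rat_eq p q \<Lambda>1 \<Lambda>2 \<longleftrightarrow>
     tensor_eq p q (\<lambda>us ls. mps_mult (snd \<Lambda>2) (fst \<Lambda>1 us ls))
                   (\<lambda>us ls. mps_mult (snd \<Lambda>1) (fst \<Lambda>2 us ls))"

text \<open>Quotient rule: L_X(Omega/f) = (f L_X Omega - X(f) Omega) / f^2.\<close>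
definition rat_lie :: "nat \<Rightarrow> nat \<Rightarrow> 'n::finite vf \<Rightarrow> 'n rtensor \<Rightarrow> 'n rtensor" where
  "rat_lie p q X \<Lambda> =
     ((\<lambda>us ls. mps_sub (mps_mult (snd \<Lambda>) (lie_tensor p q X (fst \<Lambda>) us ls))
                       (mps_mult (vf_apply X (snd \<Lambda>)) (fst \<Lambda> us ls))),
      mps_mult (snd \<Lambda>) (snd \<Lambda>))"

definition rat_zero :: "'n rtensor" where
  "rat_zero = ((\<lambda>_ _. mps_zero), mps_const 1)"

definition rat_smul :: "'n::finite mps \<Rightarrow> 'n rtensor \<Rightarrow> 'n rtensor" where
  "rat_smul g \<Lambda> = ((\<lambda>us ls. mps_mult g (fst \<Lambda> us ls)), snd \<Lambda>)"

end

theory Submission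
  imports Defs "HOL-Library.Function_Algebras" "HOL-Library.FuncSet"
    "HOL-Computational_Algebra.Polynomial"
begin

text \<open>Write \<Lambda> = \<Omega>/f. If f D(\<Omega>) = X(f) \<Omega> for the twisted Lie derivative D = L_X - h, where h has
  weight zero under X^s, then f P(D)\<Omega> = (P(X) f) \<Omega> for every polynomial P. Up to any given order, X and D
  act on finite-dimensional spaces and have a Jordan decomposition with semisimple parts X^s and
  L_{X^s} - h(0). Incommensurability makes the weight of Z_k a function of the weight of X^s, so
  interpolation at the eigenvalues gives a polynomial P for which P(X) agrees with Z_k and P(D) with
  L_{Z_k} minus a constant, up to that order; no factorisation of \<Omega> and f is needed. A general g is
  reduced to its weight-zero part h by solving X(v) = h - g and replacing \<Omega> by exp(v) \<Omega>.\<close>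

section \<open>Formal power series\<close>

text \<open>A formal series meets infinitely many weights, so in general no single polynomial in X
  equals Z_k. P therefore depends on an order r, identities are shown modulo order r, and they
  become exact because the filtration by order is separated. No Jordan decomposition is constructed:
  on tensors of one weight, D minus its eigenvalue is shown to gain order under iteration. This
  needs D to respect weights, which is why the factor h must have weight zero. As D is only an
  eigenvalue plus a nilpotent operator, P is prescribed modulo powers of linear factors, not just at
  points. The main obstacle is that one P must serve both f and \<Omega>. Eigenvalues on functions
  lie in the lattice spanned by the \<rho> k over the integers, those of D in its translate by -
  h(0). If h(0) is outside the lattice, the two sets are disjoint and P is prescribed on each
  separately. If it is inside, lattice coordinates are additive, and the two prescriptions agree
  once the k-th coordinate of h(0) is subtracted; this is the origin of the constant.\<close>

notation mps_mult (infixl "\<odot>" 70)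

abbreviation unit_idx :: "'n \<Rightarrow> 'n \<Rightarrow> nat" where
  "unit_idx i \<equiv> (\<lambda>k. if k = i then 1 else 0)"

text \<open>A symmetric index set for the Cauchy product: commutativity, associativity and the
  Leibniz rule become reindexings without subtraction of multi-indices.\<close>

definition splits :: "('n \<Rightarrow> nat) \<Rightarrow> (('n \<Rightarrow> nat) \<times> ('n \<Rightarrow> nat)) set" where
  "splits \<alpha> = {(\<beta>, \<delta>). \<beta> + \<delta> = \<alpha>}"

lemma finite_multiindex_le: "finite {\<beta>. \<forall>i::'n::finite. \<beta> i \<le> (\<alpha> i :: nat)}"
proof (rule finite_subset)
  show "{\<beta>. \<forall>i. \<beta> i \<le> \<alpha> i} \<subseteq> (\<Pi>\<^sub>E i\<in>UNIV. {..\<alpha> i})"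
    by (simp add: subset_iff PiE_iff)
qed (simp add: finite_PiE)

lemma finite_multiindex_degree_less: "finite {\<alpha> :: 'n::finite \<Rightarrow> nat. sum \<alpha> UNIV < r}"
proof (rule finite_subset)
  show "{\<alpha> :: 'n \<Rightarrow> nat. sum \<alpha> UNIV < r} \<subseteq> {\<alpha>. \<forall>i. \<alpha> i \<le> r}"
  proof clarify
    fix \<alpha> :: "'n \<Rightarrow> nat" and i assume "sum \<alpha> UNIV < r"
    moreover have "\<alpha> i \<le> sum \<alpha> UNIV" by (rule member_le_sum) auto
    ultimately show "\<alpha> i \<le> r" by simp
  qed
qed (rule finite_multiindex_le)

lemma finite_splits [simp]: "finite (splits (\<alpha> :: 'n::finite \<Rightarrow> nat))"
proof (rule finite_subset)
  show "splits \<alpha> \<subseteq> {\<beta>. \<forall>i. \<beta> i \<le> \<alpha> i} \<times> {\<beta>. \<forall>i. \<beta> i \<le> \<alpha> i}"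
    by (auto simp: splits_def)
qed (intro finite_cartesian_product finite_multiindex_le)

lemma mps_mult_splits: "(f \<odot> g) \<alpha> = (\<Sum>(\<beta>, \<delta>)\<in>splits \<alpha>. f \<beta> * g \<delta>)"
  unfolding mps_mult_def
proof (rule sum.reindex_bij_witness[of _ fst "\<lambda>\<beta>. (\<beta>, \<alpha> - \<beta>)"])
  fix x assume "x \<in> splits \<alpha>"
  moreover obtain \<beta> \<delta> where [simp]: "x = (\<beta>, \<delta>)" by (cases x)
  ultimately have "\<alpha> = \<beta> + \<delta>" by (simp add: splits_def)
  then show "(fst x, \<alpha> - fst x) = x" "fst x \<in> {\<beta>. \<forall>i. \<beta> i \<le> \<alpha> i}" by simp_all
qed (simp_all add: splits_def fun_eq_iff fun_diff_def)

lemma mps_mult_nonzeroE: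
  assumes "(f \<odot> g) \<alpha> \<noteq> 0"
  obtains \<beta> \<delta> where "\<beta> + \<delta> = \<alpha>" "f \<beta> \<noteq> 0" "g \<delta> \<noteq> 0"
proof -
  from assms obtain x where "x \<in> splits \<alpha>" "(case x of (\<beta>, \<delta>) \<Rightarrow> f \<beta> * g \<delta>) \<noteq> 0"
    unfolding mps_mult_splits by (meson sum.neutral)
  then show ?thesis using that by (auto simp: splits_def)
qed

lemma mps_mult_commute: "f \<odot> g = g \<odot> f"
proof
  fix \<alpha>
  show "(f \<odot> g) \<alpha> = (g \<odot> f) \<alpha>"
    unfolding mps_mult_splits
    by (rule sum.reindex_bij_witness[of _ prod.swap prod.swap]) (auto simp: splits_def add.commute)
qed

lemma mps_mult_assoc: "(f \<odot> g) \<odot> h = f \<odot> (g \<odot> h)"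
proof
  fix \<alpha>
  have "((f \<odot> g) \<odot> h) \<alpha> = (\<Sum>x\<in>splits \<alpha>. \<Sum>y\<in>splits (fst x). f (fst y) * g (snd y) * h (snd x))"
    by (simp add: mps_mult_splits sum_distrib_right case_prod_beta)
  also have "\<dots> = (\<Sum>(x, y)\<in>(SIGMA x:splits \<alpha>. splits (fst x)). f (fst y) * g (snd y) * h (snd x))"
    by (rule sum.Sigma) auto
  \<comment> \<open>Both sides run over triples of multi-indices with sum \<alpha>; the bijection
    only changes the bracketing.\<close>
  also have "\<dots> = (\<Sum>(x, y)\<in>(SIGMA x:splits \<alpha>. splits (snd x)). f (fst x) * (g (fst y) * h (snd y)))"
    by (rule sum.reindex_bij_witness[of _ "\<lambda>(x, y). ((fst x + fst y, snd y), (fst x, fst y))"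
            "\<lambda>(x, y). ((fst y, snd y + snd x), (snd y, snd x))"])
       (auto simp: splits_def add.assoc)
  also have "\<dots> = (\<Sum>x\<in>splits \<alpha>. \<Sum>y\<in>splits (snd x). f (fst x) * (g (fst y) * h (snd y)))"
    by (rule sum.Sigma[symmetric]) auto
  also have "\<dots> = (f \<odot> (g \<odot> h)) \<alpha>"
    by (simp add: mps_mult_splits sum_distrib_left case_prod_beta)
  finally show "((f \<odot> g) \<odot> h) \<alpha> = (f \<odot> (g \<odot> h)) \<alpha>" .
qed

lemma mps_mult_left_commute: "f \<odot> (g \<odot> h) = g \<odot> (f \<odot> h)"
  by (metis mps_mult_assoc mps_mult_commute)

lemmas mps_mult_ac = mps_mult_assoc mps_mult_commute mps_mult_left_commute

lemma mps_mult_add_left: "(f + g) \<odot> h = f \<odot> h + g \<odot> h"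
  by (rule ext) (simp add: mps_mult_splits case_prod_beta algebra_simps sum.distrib)

lemma mps_mult_add_right: "h \<odot> (f + g) = h \<odot> f + h \<odot> g"
  by (metis mps_mult_add_left mps_mult_commute)

lemma mps_mult_diff_left: "(f - g) \<odot> h = f \<odot> h - g \<odot> h"
  by (rule ext) (simp add: mps_mult_splits case_prod_beta algebra_simps sum_subtractf)

lemma mps_mult_diff_right: "h \<odot> (f - g) = h \<odot> f - h \<odot> g"
  by (metis mps_mult_diff_left mps_mult_commute)

lemmas mps_distribs = mps_mult_add_left mps_mult_add_right mps_mult_diff_left mps_mult_diff_right

lemma mps_mult_zero [simp]: "0 \<odot> f = 0" "f \<odot> 0 = 0"
  by (auto simp: fun_eq_iff mps_mult_splits)

lemma mps_const_nonzeroD: "mps_const c \<beta> \<noteq> 0 \<Longrightarrow> \<beta> = (\<lambda>_. 0)"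
  unfolding mps_const_def by presburger

lemma mps_var_nonzeroD: "mps_var i \<beta> \<noteq> 0 \<Longrightarrow> \<beta> = unit_idx i"
  unfolding mps_var_def by presburger

lemma mps_mult_const_left:
  fixes f :: "'n::finite mps"
  shows "(mps_const c \<odot> f) \<alpha> = c * f \<alpha>"
proof -
  have "(mps_const c \<odot> f) \<alpha> = (\<Sum>(\<beta>, \<delta>)\<in>{((\<lambda>_::'n. 0), \<alpha>)}. mps_const c \<beta> * f \<delta>)"
    unfolding mps_mult_splits
  proof (rule sum.mono_neutral_right)
    show "{((\<lambda>_::'n. 0), \<alpha>)} \<subseteq> splits \<alpha>"
      by (auto simp: splits_def)
    have "\<delta> = \<alpha>" if "(\<lambda>_. 0, \<delta>) \<in> splits \<alpha>" for \<delta>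
      using that by (auto simp: splits_def)
    then show "\<forall>x\<in>splits \<alpha> - {((\<lambda>_::'n. 0), \<alpha>)}. (case x of (\<beta>, \<delta>) \<Rightarrow> mps_const c \<beta> * f \<delta>) = 0"
      using mps_const_nonzeroD by fastforce
  qed simp
  then show ?thesis by (simp add: mps_const_def)
qed

lemma mps_const_1_mult [simp]: "mps_const 1 \<odot> f = f" "f \<odot> mps_const 1 = f"
  by (simp_all add: fun_eq_iff mps_mult_const_left mps_mult_commute[of f])

lemma mps_mult_var_left:
  "(mps_var i \<odot> f) \<alpha> = (if \<alpha> i = 0 then 0 else f (\<alpha>(i := \<alpha> i - 1)))"
proof (cases "\<alpha> i = 0")
  case True
  then show ?thesis
  proof -
    have "\<beta> \<noteq> unit_idx i" if "(\<beta>, \<delta>) \<in> splits \<alpha>" for \<beta> \<delta>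
      using that True by (auto simp: splits_def)
    then have "(mps_var i \<odot> f) \<alpha> = 0"
      unfolding mps_mult_splits mps_var_def by (auto intro!: sum.neutral)
    with True show ?thesis by simp
  qed
next
  case False
  have "\<delta> = \<alpha> - \<beta>" if "(\<beta>, \<delta>) \<in> splits \<alpha>" for \<beta> \<delta>
    using that by (auto simp: splits_def)
  moreover have "\<alpha> - unit_idx i = \<alpha>(i := \<alpha> i - 1)"
    by auto
  ultimately have *: "(\<beta>, \<delta>) \<in> splits \<alpha> \<Longrightarrow> \<beta> = unit_idx i \<Longrightarrow> \<delta> = \<alpha>(i := \<alpha> i - 1)" for \<beta> \<delta>
    by simp
  have "(mps_var i \<odot> f) \<alpha> =
     (\<Sum>(\<beta>, \<delta>)\<in>{(unit_idx i, \<alpha>(i := \<alpha> i - 1))}. mps_var i \<beta> * f \<delta>)"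
    unfolding mps_mult_splits
  proof (rule sum.mono_neutral_right)
    show "{(unit_idx i, \<alpha>(i := \<alpha> i - 1))} \<subseteq> splits \<alpha>"
      using False by (auto simp: splits_def)
    show "\<forall>x\<in>splits \<alpha> - {(unit_idx i, \<alpha>(i := \<alpha> i - 1))}.
        (case x of (\<beta>, \<delta>) \<Rightarrow> mps_var i \<beta> * f \<delta>) = 0"
      using * mps_var_nonzeroD by fastforce
  qed simp
  then show ?thesis using False by (simp add: mps_var_def)
qed

text \<open>Minimising one coordinate after the other yields a sum of indices that arises in only one
  way, which replaces a monomial order.\<close>

lemma unique_sum_on:
  fixes S T :: "('n \<Rightarrow> nat) set"
  assumes "finite A" "S \<noteq> {}" "T \<noteq> {}"
  shows "\<exists>\<alpha>\<in>S. \<exists>\<beta>\<in>T. \<forall>\<alpha>'\<in>S. \<forall>\<beta>'\<in>T. \<alpha>' + \<beta>' = \<alpha> + \<beta> \<longrightarrow> (\<forall>i\<in>A. \<alpha>' i = \<alpha> i \<and> \<beta>' i = \<beta> i)"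
  using assms
proof (induction A arbitrary: S T rule: finite_induct)
  case empty
  then show ?case by auto
next
  case (insert j A)
  obtain \<sigma> where \<sigma>: "\<sigma> \<in> S" "\<And>\<alpha>. \<alpha> \<in> S \<Longrightarrow> \<sigma> j \<le> \<alpha> j"
    using ex_has_least_nat[of "\<lambda>\<alpha>. \<alpha> \<in> S" _ "\<lambda>\<alpha>. \<alpha> j"] insert.prems by (metis ex_in_conv)
  obtain \<theta> where \<theta>: "\<theta> \<in> T" "\<And>\<alpha>. \<alpha> \<in> T \<Longrightarrow> \<theta> j \<le> \<alpha> j"
    using ex_has_least_nat[of "\<lambda>\<alpha>. \<alpha> \<in> T" _ "\<lambda>\<alpha>. \<alpha> j"] insert.prems by (metis ex_in_conv)
  define S' where "S' = {\<alpha>\<in>S. \<alpha> j = \<sigma> j}"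
  define T' where "T' = {\<alpha>\<in>T. \<alpha> j = \<theta> j}"
  have "S' \<noteq> {}" "T' \<noteq> {}" using \<sigma> \<theta> by (auto simp: S'_def T'_def)
  from insert.IH[OF this] obtain \<alpha> \<beta> where ab: "\<alpha> \<in> S'" "\<beta> \<in> T'"
    "\<And>\<alpha>' \<beta>'. \<alpha>' \<in> S' \<Longrightarrow> \<beta>' \<in> T' \<Longrightarrow> \<alpha>' + \<beta>' = \<alpha> + \<beta> \<Longrightarrow> \<forall>i\<in>A. \<alpha>' i = \<alpha> i \<and> \<beta>' i = \<beta> i"
    by blast
  have ab': "\<alpha> \<in> S" "\<beta> \<in> T" "\<alpha> j = \<sigma> j" "\<beta> j = \<theta> j"
    using ab(1,2) by (simp_all add: S'_def T'_def)
  have "\<forall>i\<in>insert j A. \<alpha>' i = \<alpha> i \<and> \<beta>' i = \<beta> i"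
    if "\<alpha>' \<in> S" "\<beta>' \<in> T" "\<alpha>' + \<beta>' = \<alpha> + \<beta>" for \<alpha>' \<beta>'
  proof -
    \<comment> \<open>Each summand is at least its minimum, so equality of the sums makes both
      minimal; the pair lies in \<open>S'\<close> and \<open>T'\<close>, where the induction
      hypothesis applies.\<close>
    have "\<alpha>' j + \<beta>' j = \<sigma> j + \<theta> j"
      using fun_cong[OF that(3), of j] ab' by simp
    with \<sigma>(2)[OF that(1)] \<theta>(2)[OF that(2)] have "\<alpha>' j = \<sigma> j" "\<beta>' j = \<theta> j" by linarith+
    moreover from this have "\<alpha>' \<in> S'" "\<beta>' \<in> T'"
      using that(1,2) by (simp_all add: S'_def T'_def)
    from ab(3)[OF this that(3)] have "\<forall>i\<in>A. \<alpha>' i = \<alpha> i \<and> \<beta>' i = \<beta> i" .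
    ultimately show ?thesis using ab' by simp
  qed
  with ab'(1,2) show ?case by blast
qed

text \<open>At a sum of support indices that arises in one way only, the Cauchy sum collapses to one
  nonzero product. Cancellation of the denominator f and of the exponential factor rests on
  this.\<close>

lemma mps_mult_eq_0_iff: "f \<odot> g = 0 \<longleftrightarrow> f = 0 \<or> g = (0 :: 'n::finite mps)"
proof
  assume fg: "f \<odot> g = 0"
  show "f = 0 \<or> g = 0"
  proof (rule ccontr)
    assume "\<not> ?thesis"
    then have "{\<alpha>. f \<alpha> \<noteq> 0} \<noteq> {}" "{\<alpha>. g \<alpha> \<noteq> 0} \<noteq> {}" by (auto simp: fun_eq_iff)
    from unique_sum_on[OF finite_UNIV this] obtain \<alpha> \<beta> where ab: "f \<alpha> \<noteq> 0" "g \<beta> \<noteq> 0"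
      and unique: "\<forall>\<alpha>'\<in>{\<alpha>. f \<alpha> \<noteq> 0}. \<forall>\<beta>'\<in>{\<alpha>. g \<alpha> \<noteq> 0}. \<alpha>' + \<beta>' = \<alpha> + \<beta> \<longrightarrow>
        (\<forall>i\<in>UNIV. \<alpha>' i = \<alpha> i \<and> \<beta>' i = \<beta> i)"
      by blast
    have *: "\<alpha>' = \<alpha> \<and> \<beta>' = \<beta>" if "f \<alpha>' \<noteq> 0" "g \<beta>' \<noteq> 0" "(\<alpha>', \<beta>') \<in> splits (\<alpha> + \<beta>)" for \<alpha>' \<beta>'
    proof -
      have "\<alpha>' + \<beta>' = \<alpha> + \<beta>" using that(3) by (simp add: splits_def)
      with unique that(1,2) have "\<forall>i. \<alpha>' i = \<alpha> i \<and> \<beta>' i = \<beta> i" by blast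
      then show ?thesis by (auto intro: ext)
    qed
    have "(f \<odot> g) (\<alpha> + \<beta>) = (\<Sum>(\<beta>, \<delta>)\<in>{(\<alpha>, \<beta>)}. f \<beta> * g \<delta>)"
      unfolding mps_mult_splits
    proof (rule sum.mono_neutral_right)
      show "{(\<alpha>, \<beta>)} \<subseteq> splits (\<alpha> + \<beta>)" by (simp add: splits_def)
    qed (use * in auto)
    with fg ab show False by simp
  qed
qed auto

lemma mps_mult_left_cancel: "f \<noteq> 0 \<Longrightarrow> f \<odot> g = f \<odot> h \<longleftrightarrow> g = h"
  using mps_mult_eq_0_iff[of f "g - h"] by (simp add: mps_distribs)

lemma mps_deriv_add: "mps_deriv k (f + g) = mps_deriv k f + mps_deriv k g"
  by (rule ext) (simp add: mps_deriv_def algebra_simps)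

lemma mps_deriv_shift: "mps_deriv k f \<alpha> = of_nat (\<alpha> k + 1) * f (\<alpha> + unit_idx k)"
proof -
  have "\<alpha>(k := \<alpha> k + 1) = \<alpha> + unit_idx k" by (simp add: fun_eq_iff)
  then show ?thesis by (simp only: mps_deriv_def)
qed

text \<open>On splittings (\<beta>, \<delta>) of \<open>\<alpha> + unit_idx k\<close>, the factor
  \<open>\<alpha> k + 1\<close> equals \<open>\<beta> k + \<delta> k\<close>, and each part gives
  one Leibniz term. In \<open>left\<close>, the terms with \<open>\<beta> k = 0\<close> drop out and
  the others are shifted by \<open>unit_idx k\<close>.\<close>

lemma mps_deriv_mult: "mps_deriv k (f \<odot> g) = mps_deriv k f \<odot> g + f \<odot> mps_deriv k g"
proof
  fix \<alpha> :: "'a \<Rightarrow> nat"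
  have left: "(\<Sum>(\<beta>, \<delta>)\<in>splits (\<alpha> + unit_idx k). of_nat (\<beta> k) * f \<beta> * g \<delta>) = (mps_deriv k f \<odot> g) \<alpha>"
    for f g :: "'a mps"
  proof -
    have "(\<Sum>(\<beta>, \<delta>)\<in>splits (\<alpha> + unit_idx k). of_nat (\<beta> k) * f \<beta> * g \<delta>)
      = (\<Sum>(\<beta>, \<delta>)\<in>{(\<beta>, \<delta>)\<in>splits (\<alpha> + unit_idx k). \<beta> k > 0}. of_nat (\<beta> k) * f \<beta> * g \<delta>)"
      by (rule sum.mono_neutral_right) auto
    also have "\<dots> = (\<Sum>(\<beta>, \<delta>)\<in>splits \<alpha>. mps_deriv k f \<beta> * g \<delta>)"
    proof (rule sum.reindex_bij_witness[where
        i = "\<lambda>(\<beta>, \<delta>). (\<beta> + unit_idx k, \<delta>)" and j = "\<lambda>(\<beta>, \<delta>). (\<beta> - unit_idx k, \<delta>)"])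
      fix x assume "x \<in> {(\<beta>, \<delta>)\<in>splits (\<alpha> + unit_idx k). \<beta> k > 0}"
      moreover obtain \<beta> \<delta> where [simp]: "x = (\<beta>, \<delta>)" by (cases x)
      ultimately have x: "\<beta> + \<delta> = \<alpha> + unit_idx k" "\<beta> k > 0" by (auto simp: splits_def)
      have eq: "\<beta> - unit_idx k + unit_idx k = \<beta>"
        using x(2) by (simp add: fun_eq_iff)
      then show "(case (case x of (\<beta>, \<delta>) \<Rightarrow> (\<beta> - unit_idx k, \<delta>)) of (\<beta>, \<delta>) \<Rightarrow> (\<beta> + unit_idx k, \<delta>)) = x"
        by simp
      have "\<beta> - unit_idx k + \<delta> + unit_idx k = \<alpha> + unit_idx k"
        using eq x(1) by (metis add.assoc add.commute)
      then show "(case x of (\<beta>, \<delta>) \<Rightarrow> (\<beta> - unit_idx k, \<delta>)) \<in> splits \<alpha>"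
        unfolding splits_def using add_right_imp_eq by auto
      have "(\<beta> - unit_idx k) k + 1 = \<beta> k" using x(2) by simp
      then have "mps_deriv k f (\<beta> - unit_idx k) = of_nat (\<beta> k) * f \<beta>"
        by (simp only: mps_deriv_shift eq)
      then show "(case (case x of (\<beta>, \<delta>) \<Rightarrow> (\<beta> - unit_idx k, \<delta>)) of (\<beta>, \<delta>) \<Rightarrow> mps_deriv k f \<beta> * g \<delta>)
        = (case x of (\<beta>, \<delta>) \<Rightarrow> of_nat (\<beta> k) * f \<beta> * g \<delta>)" by simp
    next
      fix x assume "x \<in> splits \<alpha>"
      moreover obtain \<beta> \<delta> where [simp]: "x = (\<beta>, \<delta>)" by (cases x)
      ultimately have x: "\<beta> + \<delta> = \<alpha>" by (simp add: splits_def)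
      show "(case (case x of (\<beta>, \<delta>) \<Rightarrow> (\<beta> + unit_idx k, \<delta>)) of (\<beta>, \<delta>) \<Rightarrow> (\<beta> - unit_idx k, \<delta>)) = x"
        by (simp add: fun_eq_iff)
      have "\<beta> + unit_idx k + \<delta> = \<alpha> + unit_idx k"
        using x by (metis add.assoc add.commute)
      then show "(case x of (\<beta>, \<delta>) \<Rightarrow> (\<beta> + unit_idx k, \<delta>)) \<in>
          {(\<beta>, \<delta>)\<in>splits (\<alpha> + unit_idx k). \<beta> k > 0}"
        by (simp add: splits_def)
    qed
    finally show ?thesis by (simp only: mps_mult_splits)
  qed
  have "mps_deriv k (f \<odot> g) \<alpha> =
    (\<Sum>(\<beta>, \<delta>)\<in>splits (\<alpha> + unit_idx k). of_nat (\<alpha> k + 1) * (f \<beta> * g \<delta>))"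
    unfolding mps_deriv_shift mps_mult_splits by (simp add: sum_distrib_left case_prod_beta)
  also have "\<dots> = (\<Sum>(\<beta>, \<delta>)\<in>splits (\<alpha> + unit_idx k). of_nat (\<beta> k) * f \<beta> * g \<delta> + of_nat (\<delta> k) * g \<delta> * f \<beta>)"
  proof (rule sum.cong)
    fix x assume "x \<in> splits (\<alpha> + unit_idx k)"
    moreover obtain \<beta> \<delta> where [simp]: "x = (\<beta>, \<delta>)" by (cases x)
    ultimately have "\<beta> + \<delta> = \<alpha> + unit_idx k" by (simp add: splits_def)
    from fun_cong[OF this, of k] have "\<alpha> k + 1 = \<beta> k + \<delta> k" by simp
    then show "(case x of (\<beta>, \<delta>) \<Rightarrow> of_nat (\<alpha> k + 1) * (f \<beta> * g \<delta>))
       = (case x of (\<beta>, \<delta>) \<Rightarrow> of_nat (\<beta> k) * f \<beta> * g \<delta> + of_nat (\<delta> k) * g \<delta> * f \<beta>)"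
      by (simp only: of_nat_add prod.case) (simp add: algebra_simps)
  qed simp
  also have "\<dots> = (mps_deriv k f \<odot> g) \<alpha>
      + (\<Sum>(\<beta>, \<delta>)\<in>splits (\<alpha> + unit_idx k). of_nat (\<delta> k) * g \<delta> * f \<beta>)"
    unfolding left[symmetric] by (simp add: case_prod_beta sum.distrib)
  also have "(\<Sum>(\<beta>, \<delta>)\<in>splits (\<alpha> + unit_idx k). of_nat (\<delta> k) * g \<delta> * f \<beta>)
      = (\<Sum>(\<beta>, \<delta>)\<in>splits (\<alpha> + unit_idx k). of_nat (\<beta> k) * g \<beta> * f \<delta>)"
    by (rule sum.reindex_bij_witness[of _ prod.swap prod.swap]) (auto simp: splits_def add.commute)
  also have "\<dots> = (f \<odot> mps_deriv k g) \<alpha>"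
    unfolding left by (simp add: mps_mult_commute)
  finally show "mps_deriv k (f \<odot> g) \<alpha> = (mps_deriv k f \<odot> g + f \<odot> mps_deriv k g) \<alpha>" by simp
qed

section \<open>Order of vanishing, derivations and Lie derivatives\<close>

lemma sum_fun_apply: "(\<Sum>i\<in>A. F i) x = (\<Sum>i\<in>A. F i x)"
  for F :: "'i \<Rightarrow> 'b \<Rightarrow> 'c::comm_monoid_add"
  by (induction A rule: infinite_finite_induct) auto

lemma mps_mult_sum_left: "(\<Sum>i\<in>A. f i) \<odot> g = (\<Sum>i\<in>A. f i \<odot> g)"
  by (induction A rule: infinite_finite_induct) (simp_all only: sum.infinite sum.empty sum.insert not_False_eq_True mps_mult_zero mps_mult_add_left)

lemma mps_mult_sum_right: "g \<odot> (\<Sum>i\<in>A. f i) = (\<Sum>i\<in>A. g \<odot> f i)"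
  by (induction A rule: infinite_finite_induct) (simp_all only: sum.infinite sum.empty sum.insert not_False_eq_True mps_mult_zero mps_mult_add_right)

lemma mps_mult_uminus_left: "(- f) \<odot> g = - (f \<odot> g)"
  using mps_mult_diff_left[of 0 f g] by simp

lemma mps_const_mult: "mps_const c \<odot> mps_const d = mps_const (c * d)"
  by (rule ext) (simp add: mps_mult_const_left, simp add: mps_const_def)

lemma mps_const_add: "mps_const (c + d) = mps_const c + mps_const d"
  by (rule ext) (simp add: mps_const_def)

lemma mps_const_0 [simp]: "mps_const 0 = 0"
  by (rule ext) (simp add: mps_const_def)

lemma mps_deriv_const [simp]: "mps_deriv k (mps_const c) = 0"
proof
  fix \<alpha> :: "'a \<Rightarrow> nat"
  have "(\<alpha>(k := \<alpha> k + 1)) k \<noteq> 0" by simp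
  then have "\<alpha>(k := \<alpha> k + 1) \<noteq> (\<lambda>_. 0)" by metis
  then show "mps_deriv k (mps_const c) \<alpha> = 0 \<alpha>" by (simp add: mps_deriv_def mps_const_def)
qed

lemma mps_deriv_0 [simp]: "mps_deriv k 0 = 0"
  by (rule ext) (simp add: mps_deriv_def)

lemma mps_deriv_sum: "mps_deriv k (\<Sum>i\<in>A. f i) = (\<Sum>i\<in>A. mps_deriv k (f i))"
  by (induction A rule: infinite_finite_induct) (simp_all only: sum.infinite sum.empty sum.insert not_False_eq_True mps_deriv_0 mps_deriv_add)

lemma mps_deriv_const_mult: "mps_deriv k (mps_const c \<odot> f) = mps_const c \<odot> mps_deriv k f"
  by (simp add: mps_deriv_mult)

lemma mps_deriv_var: "mps_deriv k (mps_var i) = (if k = i then mps_const 1 else 0)"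
proof
  fix \<alpha> :: "'a \<Rightarrow> nat"
  have "\<alpha>(k := \<alpha> k + 1) = unit_idx i \<longleftrightarrow> k = i \<and> \<alpha> = (\<lambda>_. 0)"
  proof
    assume eq: "\<alpha>(k := \<alpha> k + 1) = unit_idx i"
    from fun_cong[OF eq, of k] have "k = i" "\<alpha> k = 0" by (auto split: if_splits)
    moreover have "\<alpha> j = 0" if "j \<noteq> k" for j
      using fun_cong[OF eq, of j] that \<open>k = i\<close> by simp
    ultimately show "k = i \<and> \<alpha> = (\<lambda>_. 0)" by (metis ext)
  qed (simp add: fun_eq_iff)
  then show "mps_deriv k (mps_var i) \<alpha> = (if k = i then mps_const 1 else 0) \<alpha>"
    by (simp add: mps_deriv_def mps_var_def mps_const_def)
qed

text \<open>A filtration instead of a valuation, so that 0 has every order. Working modulo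
  \<open>mord r\<close> replaces passing to finite-dimensional spaces of jets.\<close>

definition mord :: "nat \<Rightarrow> 'n::finite mps \<Rightarrow> bool" where
  "mord r f \<longleftrightarrow> (\<forall>\<alpha>. sum \<alpha> UNIV < r \<longrightarrow> f \<alpha> = 0)"

lemma mord_0_left [simp]: "mord 0 f" and mord_zero [simp]: "mord r 0"
  by (auto simp: mord_def)

lemma mord_mono: "mord r f \<Longrightarrow> s \<le> r \<Longrightarrow> mord s f"
  by (auto simp: mord_def)

lemma mord_add: "mord r f \<Longrightarrow> mord r g \<Longrightarrow> mord r (f + g)"
  and mord_diff: "mord r f \<Longrightarrow> mord r g \<Longrightarrow> mord r (f - g)"
  by (auto simp: mord_def)

lemma mord_sum: "(\<And>i. i \<in> A \<Longrightarrow> mord r (f i)) \<Longrightarrow> mord r (\<Sum>i\<in>A. f i)"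
  by (simp add: mord_def sum_fun_apply)

lemma mord_mult:
  assumes "mord r f" "mord s g"
  shows "mord (r + s) (f \<odot> g)"
  unfolding mord_def
proof (intro allI impI)
  fix \<alpha> :: "'a \<Rightarrow> nat" assume less: "sum \<alpha> UNIV < r + s"
  show "(f \<odot> g) \<alpha> = 0"
  proof (rule ccontr)
    assume "(f \<odot> g) \<alpha> \<noteq> 0"
    then obtain \<beta> \<delta> where "\<beta> + \<delta> = \<alpha>" "f \<beta> \<noteq> 0" "g \<delta> \<noteq> 0"
      by (rule mps_mult_nonzeroE)
    moreover from this assms have "r \<le> sum \<beta> UNIV" "s \<le> sum \<delta> UNIV"
      by (metis mord_def not_le)+
    ultimately show False using less by (auto simp: sum.distrib)
  qed
qed

lemma mord_mult_right: "mord r g \<Longrightarrow> mord r (f \<odot> g)"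
  using mord_mult[of 0 f r g] by simp

lemma mord_deriv: "mord r f \<Longrightarrow> mord (r - 1) (mps_deriv k f)"
  unfolding mord_def mps_deriv_shift by (auto simp: sum.distrib)

lemma mord_eq_zeroI: "(\<And>r. mord r f) \<Longrightarrow> f = 0"
  unfolding mord_def by (metis ext lessI zero_fun_apply)

lemma mord_1_iff: "mord (Suc 0) f \<longleftrightarrow> f (\<lambda>_. 0) = 0"
proof -
  have "sum \<alpha> UNIV = 0 \<longleftrightarrow> \<alpha> = (\<lambda>_. 0)" for \<alpha> :: "'a \<Rightarrow> nat"
    by (auto simp: fun_eq_iff)
  then show ?thesis by (simp add: mord_def)
qed

lemma vf_apply_alt: "vf_apply V f = (\<Sum>k\<in>UNIV. V k \<odot> mps_deriv k f)"
  by (rule ext) (simp add: vf_apply_def sum_fun_apply)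

lemma vf_apply_add: "vf_apply V (f + g) = vf_apply V f + vf_apply V g"
  by (simp add: vf_apply_alt mps_deriv_add mps_distribs sum.distrib)

lemma vf_apply_mult: "vf_apply V (f \<odot> g) = vf_apply V f \<odot> g + f \<odot> vf_apply V g"
  by (simp add: vf_apply_alt mps_deriv_mult mps_mult_add_right sum.distrib mps_mult_sum_left
      mps_mult_sum_right mps_mult_assoc mps_mult_left_commute[of f])

lemma vf_apply_const [simp]: "vf_apply V (mps_const c) = 0"
  by (simp add: vf_apply_alt)

lemma vf_apply_0 [simp]: "vf_apply V 0 = 0"
  by (simp add: vf_apply_alt)

lemma vf_apply_sum: "vf_apply V (\<Sum>i\<in>A. f i) = (\<Sum>i\<in>A. vf_apply V (f i))"
  by (induction A rule: infinite_finite_induct) (simp_all only: sum.infinite sum.empty sum.insert not_False_eq_True vf_apply_0 vf_apply_add)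

lemma vf_apply_const_mult: "vf_apply V (mps_const c \<odot> f) = mps_const c \<odot> vf_apply V f"
  by (simp add: vf_apply_mult)

lemma vf_apply_vf_add: "vf_apply (V + W) f = vf_apply V f + vf_apply W f"
  by (simp add: vf_apply_alt mps_distribs sum.distrib)

lemma mord_vf_apply:
  assumes "\<And>i. mord (Suc s) (V i)" "mord r f"
  shows "mord (r + s) (vf_apply V f)"
  unfolding vf_apply_alt
proof (rule mord_sum)
  fix k
  have "mord (Suc s + (r - 1)) (V k \<odot> mps_deriv k f)"
    using assms by (intro mord_mult mord_deriv)
  \<comment> \<open>For \<open>r = 0\<close> the truncated \<open>r - 1\<close> leaves one order to
    spare; otherwise the orders agree.\<close>
  then show "mord (r + s) (V k \<odot> mps_deriv k f)" by (rule mord_mono) auto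
qed

lemma vf_apply_diag: "vf_apply (diag_vf c) f \<alpha> = (\<Sum>j\<in>UNIV. c j * of_nat (\<alpha> j)) * f \<alpha>"
proof -
  have "(diag_vf c k \<odot> mps_deriv k f) \<alpha> = c k * of_nat (\<alpha> k) * f \<alpha>" for k
  proof -
    have "diag_vf c k = mps_const (c k) \<odot> mps_var k"
      by (rule ext) (simp add: diag_vf_def mps_mult_const_left)
    then show ?thesis
      by (simp add: mps_mult_assoc mps_mult_const_left mps_mult_var_left mps_deriv_def)
  qed
  then show ?thesis by (simp add: vf_apply_def sum_distrib_right)
qed

section \<open>Tensor fields as a module over formal functions, and their Lie derivatives\<close>

definition tmul :: "'n::finite mps \<Rightarrow> 'n tensor \<Rightarrow> 'n tensor" where
  "tmul h T = (\<lambda>us ls. h \<odot> T us ls)"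

lemma tmul_apply: "tmul h T us ls = h \<odot> T us ls"
  by (simp add: tmul_def)

lemma tmul_add_left: "tmul (f + g) T = tmul f T + tmul g T"
  and tmul_add_right: "tmul f (S + T) = tmul f S + tmul f T"
  and tmul_diff_left: "tmul (f - g) T = tmul f T - tmul g T"
  and tmul_diff_right: "tmul f (S - T) = tmul f S - tmul f T"
  by (intro ext; simp add: tmul_def mps_distribs)+

lemma tmul_tmul: "tmul f (tmul g T) = tmul (f \<odot> g) T"
  by (simp add: tmul_def mps_mult_assoc)

lemma tmul_const_0 [simp]: "tmul 0 T = 0" "tmul f 0 = 0"
  by (auto simp: tmul_def fun_eq_iff)

lemma tmul_const_1 [simp]: "tmul (mps_const 1) T = T"
  by (simp add: tmul_def)

lemma tmul_const_apply: "tmul (mps_const c) T us ls \<alpha> = c * T us ls \<alpha>"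
  by (simp add: tmul_def mps_mult_const_left)

lemma lie_tensor_alt:
  "lie_tensor p q X T us ls = vf_apply X (T us ls)
     - (\<Sum>a<p. \<Sum>k\<in>UNIV. mps_deriv k (X (us ! a)) \<odot> T (us[a := k]) ls)
     + (\<Sum>b<q. \<Sum>k\<in>UNIV. mps_deriv (ls ! b) (X k) \<odot> T us (ls[b := k]))"
  by (rule ext) (simp add: lie_tensor_def sum_fun_apply)

lemma lie_tensor_add: "lie_tensor p q X (S + T) = lie_tensor p q X S + lie_tensor p q X T"
proof (intro ext)
  fix us ls \<alpha>
  have "lie_tensor p q X (S + T) us ls = lie_tensor p q X S us ls + lie_tensor p q X T us ls"
    by (simp add: lie_tensor_alt vf_apply_add mps_distribs sum.distrib)
  then show "lie_tensor p q X (S + T) us ls \<alpha> = (lie_tensor p q X S + lie_tensor p q X T) us ls \<alpha>"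
    by simp
qed

lemma lie_tensor_tmul:
  "lie_tensor p q X (tmul h T) = tmul (vf_apply X h) T + tmul h (lie_tensor p q X T)"
proof (intro ext)
  fix us ls \<alpha>
  have "lie_tensor p q X (tmul h T) us ls = vf_apply X h \<odot> T us ls + h \<odot> lie_tensor p q X T us ls"
    by (simp add: lie_tensor_alt tmul_def vf_apply_mult mps_distribs mps_mult_sum_right
        mps_mult_left_commute)
  then show "lie_tensor p q X (tmul h T) us ls \<alpha> =
      (tmul (vf_apply X h) T + tmul h (lie_tensor p q X T)) us ls \<alpha>"
    by (simp add: tmul_def)
qed

lemma lie_tensor_vf_add: "lie_tensor p q (X + Y) T = lie_tensor p q X T + lie_tensor p q Y T"
proof (intro ext)
  fix us ls \<alpha>
  have "lie_tensor p q (X + Y) T us ls = lie_tensor p q X T us ls + lie_tensor p q Y T us ls"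
    by (simp add: lie_tensor_alt vf_apply_vf_add mps_deriv_add mps_distribs sum.distrib)
  then show "lie_tensor p q (X + Y) T us ls \<alpha> = (lie_tensor p q X T + lie_tensor p q Y T) us ls \<alpha>"
    by simp
qed

text \<open>The eigenvalue of the Lie derivative along \<open>diag_vf c\<close> on the monomial
  tensor with coefficient x^\<alpha>, vector indices \<open>us\<close> and covector indices
  \<open>ls\<close>. Upper indices count negatively because the bracket of x_j d/dx_j with d/dx_j is
  - d/dx_j.\<close>

definition wt :: "('n::finite \<Rightarrow> complex) \<Rightarrow> nat \<Rightarrow> nat \<Rightarrow> 'n list \<Rightarrow> 'n list \<Rightarrow> ('n \<Rightarrow> nat) \<Rightarrow> complex" where
  "wt c p q us ls \<alpha> =
     (\<Sum>j\<in>UNIV. c j * of_nat (\<alpha> j)) - (\<Sum>a<p. c (us ! a)) + (\<Sum>b<q. c (ls ! b))"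

lemma mps_deriv_diag:
  fixes c :: "'n::finite \<Rightarrow> complex"
  shows "mps_deriv k (diag_vf c i) = (if k = i then mps_const (c i) else 0)"
proof -
  have "diag_vf c i = mps_const (c i) \<odot> mps_var i"
    by (rule ext) (simp add: diag_vf_def mps_mult_const_left)
  then show ?thesis by (simp add: mps_deriv_const_mult mps_deriv_var)
qed

lemma lie_tensor_diag: "lie_tensor p q (diag_vf c) T us ls \<alpha> = wt c p q us ls \<alpha> * T us ls \<alpha>"
proof -
  have 1: "(\<Sum>k\<in>UNIV. (if k = i then mps_const (c i) else 0) \<odot> F k) \<alpha> = c i * F i \<alpha>" 
    for i :: 'a and F :: "'a \<Rightarrow> 'a mps"
  proof -
    have "(\<Sum>k\<in>UNIV. (if k = i then mps_const (c i) else 0) \<odot> F k)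
        = (\<Sum>k\<in>UNIV. if k = i then mps_const (c i) \<odot> F i else 0)"
      by (rule sum.cong) auto
    then show ?thesis by (simp add: mps_mult_const_left)
  qed
  have 2: "(\<Sum>k\<in>UNIV. (if i = k then mps_const (c k) else 0) \<odot> F k) \<alpha> = c i * F i \<alpha>" 
    for i :: 'a and F :: "'a \<Rightarrow> 'a mps"
  proof -
    have "(\<Sum>k\<in>UNIV. (if i = k then mps_const (c k) else 0) \<odot> F k)
        = (\<Sum>k\<in>UNIV. if i = k then mps_const (c i) \<odot> F i else 0)"
      by (rule sum.cong) auto
    then show ?thesis by (simp add: mps_mult_const_left)
  qed
  show ?thesis
    unfolding lie_tensor_alt mps_deriv_diag plus_fun_apply fun_diff_def sum_fun_apply[of _ "{..<p}"]
      sum_fun_apply[of _ "{..<q}"] 1 2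
    by (simp add: vf_apply_diag wt_def ring_distribs sum_distrib_left sum_distrib_right)
qed

definition tord :: "nat \<Rightarrow> nat \<Rightarrow> nat \<Rightarrow> 'n::finite tensor \<Rightarrow> bool" where
  "tord p q r T \<longleftrightarrow> (\<forall>us ls. length us = p \<longrightarrow> length ls = q \<longrightarrow> mord r (T us ls))"

lemma tord_0 [simp]: "tord p q 0 T" and tord_zero [simp]: "tord p q r 0"
  by (auto simp: tord_def)

lemma tord_add: "tord p q r S \<Longrightarrow> tord p q r T \<Longrightarrow> tord p q r (S + T)"
  and tord_diff: "tord p q r S \<Longrightarrow> tord p q r T \<Longrightarrow> tord p q r (S - T)"
  by (auto simp: tord_def fun_diff_def intro: mord_add mord_diff[unfolded fun_diff_def])

lemma tord_tmul: "mord s h \<Longrightarrow> tord p q r T \<Longrightarrow> tord p q (r + s) (tmul h T)"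
  by (auto simp: tord_def tmul_def add.commute[of r] intro: mord_mult)

text \<open>Every term of the Lie derivative contains exactly one differentiation, of the tensor or
  of the field, so a field of order s + 1 raises the order by s. The cases s = 0 (all of X) and s =
  1 (its nonlinear part) are used.\<close>

lemma tord_lie:
  assumes X: "\<And>i. mord (Suc s) (X i)" and T: "tord p q r T"
  shows "tord p q (r + s) (lie_tensor p q X T)"
  unfolding tord_def lie_tensor_alt
proof (intro allI impI mord_add mord_diff mord_sum)
  fix us ls :: "'a list" assume len: "length us = p" "length ls = q"
  have dX: "mord s (mps_deriv k (X i))" for k i
    using mord_deriv[OF X] by simp
  show "mord (r + s) (vf_apply X (T us ls))"
    using T len by (intro mord_vf_apply X) (auto simp: tord_def)
  show "mord (r + s) (mps_deriv k (X (us ! a)) \<odot> T (us[a := k]) ls)" for a k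
    unfolding add.commute[of r] using T len by (intro mord_mult dX) (auto simp: tord_def)
  show "mord (r + s) (mps_deriv (ls ! b) (X k) \<odot> T us (ls[b := k]))" for b k
    unfolding add.commute[of r] using T len by (intro mord_mult dX) (auto simp: tord_def)
qed

section \<open>Weights and the nilpotent part\<close>

definition dot :: "('n::finite \<Rightarrow> complex) \<Rightarrow> ('n \<Rightarrow> nat) \<Rightarrow> complex" where
  "dot c \<alpha> = (\<Sum>j\<in>UNIV. c j * of_nat (\<alpha> j))"

lemma dot_add: "dot c (\<alpha> + \<beta>) = dot c \<alpha> + dot c \<beta>"
  by (simp add: dot_def ring_distribs sum.distrib)

lemma dot_unit_idx: "dot c (unit_idx k) = c k"
  by (simp add: dot_def if_distrib[of "\<lambda>x. c _ * of_nat x"] cong: if_cong)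

lemma wt_add_index: "wt c p q us ls (\<alpha> + \<beta>) = dot c \<alpha> + wt c p q us ls \<beta>"
  by (simp add: wt_def dot_def ring_distribs sum.distrib)

lemma sum_list_update:
  fixes c :: "'n \<Rightarrow> complex"
  assumes "length us = p" "a < p"
  shows "(\<Sum>i<p. c (us[a := k] ! i)) = (\<Sum>i<p. c (us ! i)) - c (us ! a) + c k"
proof -
  have "(\<Sum>i<p. c (us[a := k] ! i)) = c (us[a := k] ! a) + (\<Sum>i\<in>{..<p} - {a}. c (us[a := k] ! i))"
    using assms by (intro sum.remove) auto
  also have "(\<Sum>i\<in>{..<p} - {a}. c (us[a := k] ! i)) = (\<Sum>i\<in>{..<p} - {a}. c (us ! i))"
    by (rule sum.cong) auto
  also have "(\<Sum>i<p. c (us ! i)) = c (us ! a) + (\<Sum>i\<in>{..<p} - {a}. c (us ! i))"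
    using assms by (intro sum.remove) auto
  ultimately show ?thesis using assms by simp
qed

text \<open>Formal tensors are infinite sums of weight vectors, so weights are described through the
  support. Taking \<open>A\<close> as a singleton or as the complement of one gives a weight space
  and the closed span of all the others.\<close>

definition wsupp :: "('n::finite \<Rightarrow> complex) \<Rightarrow> nat \<Rightarrow> nat \<Rightarrow> complex set \<Rightarrow> 'n tensor \<Rightarrow> bool" where
  "wsupp c p q A T \<longleftrightarrow> (\<forall>us ls \<alpha>. length us = p \<longrightarrow> length ls = q \<longrightarrow> T us ls \<alpha> \<noteq> 0 \<longrightarrow>
     wt c p q us ls \<alpha> \<in> A)"

lemma wsupp_zero [simp]: "wsupp c p q A 0"
  by (simp add: wsupp_def)

lemma wsupp_add: "wsupp c p q A S \<Longrightarrow> wsupp c p q A T \<Longrightarrow> wsupp c p q A (S + T)"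
  unfolding wsupp_def by (metis add.right_neutral plus_fun_apply)

lemma wsupp_diff: "wsupp c p q A S \<Longrightarrow> wsupp c p q A T \<Longrightarrow> wsupp c p q A (S - T)"
  unfolding wsupp_def by (metis diff_zero minus_apply)

lemma wsupp_tmul:
  assumes h: "\<And>\<beta>. h \<beta> \<noteq> 0 \<Longrightarrow> dot c \<beta> = 0" and T: "wsupp c p q A T"
  shows "wsupp c p q A (tmul h T)"
  unfolding wsupp_def tmul_def
proof (intro allI impI)
  fix us ls \<alpha> assume len: "length us = p" "length ls = q" and "(h \<odot> T us ls) \<alpha> \<noteq> 0"
  then obtain \<beta> \<delta> where "\<beta> + \<delta> = \<alpha>" "h \<beta> \<noteq> 0" "T us ls \<delta> \<noteq> 0"
    by (auto elim: mps_mult_nonzeroE)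
  then show "wt c p q us ls \<alpha> \<in> A"
    using h T len by (auto simp: wsupp_def wt_add_index)
qed

lemma wsupp_tmul_const: "wsupp c p q A T \<Longrightarrow> wsupp c p q A (tmul (mps_const d) T)"
  by (rule wsupp_tmul) (auto dest!: mps_const_nonzeroD simp: dot_def)

text \<open>The assumption on X says that each of its monomials x^\<alpha> d/dx_i has weight zero
  under \<open>diag_vf c\<close>. A Lie derivative adds the weights of field and tensor, hence moves
  nothing to another weight.\<close>

lemma wsupp_lie:
  assumes X: "\<And>i \<alpha>. X i \<alpha> \<noteq> 0 \<Longrightarrow> dot c \<alpha> = c i" and T: "wsupp c p q A T"
  shows "wsupp c p q A (lie_tensor p q X T)"
  unfolding wsupp_def
proof (intro allI impI)
  fix us ls :: "'a list" and \<alpha> assume len: "length us = p" "length ls = q"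
  \<comment> \<open>Differentiating by x_k lowers the weight of a coefficient by \<open>c k\<close>;
    in the two contraction sums this balances the change of weight caused by replacing one tensor
    index.\<close>
  have dX: "dot c \<beta> + c k = c i" if "mps_deriv k (X i) \<beta> \<noteq> 0" for k i \<beta>
    using X[of i "\<beta> + unit_idx k"] that by (auto simp: mps_deriv_shift dot_add dot_unit_idx)
  assume nz: "lie_tensor p q X T us ls \<alpha> \<noteq> 0"
  show "wt c p q us ls \<alpha> \<in> A"
  proof (rule ccontr)
    assume notin: "wt c p q us ls \<alpha> \<notin> A"
    have 1: "(X k \<odot> mps_deriv k (T us ls)) \<alpha> = 0" for k
    proof (rule ccontr)
      assume "\<not> ?thesis"
      then obtain \<beta> \<delta> where bd: "\<beta> + \<delta> = \<alpha>" "X k \<beta> \<noteq> 0" "mps_deriv k (T us ls) \<delta> \<noteq> 0"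
        by (auto elim: mps_mult_nonzeroE)
      then have "T us ls (unit_idx k + \<delta>) \<noteq> 0" by (auto simp: mps_deriv_shift add.commute)
      then have "wt c p q us ls (unit_idx k + \<delta>) \<in> A" using T len by (auto simp: wsupp_def)
      with notin X[OF bd(2)] bd(1) show False by (auto simp: wt_add_index dot_unit_idx)
    qed
    have 2: "(mps_deriv k (X (us ! a)) \<odot> T (us[a := k]) ls) \<alpha> = 0" if "a < p" for a k
    proof (rule ccontr)
      assume "\<not> ?thesis"
      then obtain \<beta> \<delta> where bd: "\<beta> + \<delta> = \<alpha>" "mps_deriv k (X (us ! a)) \<beta> \<noteq> 0" "T (us[a := k]) ls \<delta> \<noteq> 0"
        by (auto elim: mps_mult_nonzeroE)
      then have "wt c p q (us[a := k]) ls \<delta> \<in> A" using T len by (auto simp: wsupp_def)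
      moreover have "wt c p q us ls \<alpha> = wt c p q (us[a := k]) ls \<delta>"
        unfolding bd(1)[symmetric] wt_add_index
        by (simp add: wt_def sum_list_update[OF len(1) that] flip: dX[OF bd(2)])
      ultimately show False using notin by simp
    qed
    have 3: "(mps_deriv (ls ! b) (X k) \<odot> T us (ls[b := k])) \<alpha> = 0" if "b < q" for b k
    proof (rule ccontr)
      assume "\<not> ?thesis"
      then obtain \<beta> \<delta> where bd: "\<beta> + \<delta> = \<alpha>" "mps_deriv (ls ! b) (X k) \<beta> \<noteq> 0" "T us (ls[b := k]) \<delta> \<noteq> 0"
        by (auto elim: mps_mult_nonzeroE)
      then have "wt c p q us (ls[b := k]) \<delta> \<in> A" using T len by (auto simp: wsupp_def)
      moreover have "wt c p q us ls \<alpha> = wt c p q us (ls[b := k]) \<delta>"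
        unfolding bd(1)[symmetric] wt_add_index
        by (simp add: wt_def sum_list_update[OF len(2) that] flip: dX[OF bd(2)])
      ultimately show False using notin by simp
    qed
    have "lie_tensor p q X T us ls \<alpha> = 0"
      by (simp add: lie_tensor_def vf_apply_def 1 2 3)
    with nz show False by simp
  qed
qed

section \<open>Sums of commuting operators that are nilpotent modulo a filtration step\<close>

lemma funpow_add_op_mod:
  fixes f g :: "'v::ab_group_add \<Rightarrow> 'v"
  assumes add: "\<And>x y. f (x + y) = f x + f y" "\<And>x y. g (x + y) = g x + g y"
    and comm: "\<And>x. f (g x) = g (f x)"
    and G: "\<And>x y. G x \<Longrightarrow> G y \<Longrightarrow> G (x + y)" "\<And>x. G x \<Longrightarrow> G (f x)" "\<And>x. G x \<Longrightarrow> G (g x)"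
    and "G ((f ^^ i) x)" "G ((g ^^ j) x)"
  shows "G (((\<lambda>x. f x + g x) ^^ (i + j)) x)"
proof -
  define s where "s = (\<lambda>x. f x + g x)"
  have s_step: "s x = f x + g x" for x
    by (simp add: s_def)
  have s_add: "(s ^^ n) (x + y) = (s ^^ n) x + (s ^^ n) y" for n x y
    by (induction n) (simp_all add: s_def add algebra_simps)
  have s_G: "G ((s ^^ n) x)" if "G x" for n x
    using that by (induction n) (simp_all add: s_def G)
  have pow_comm: "(f ^^ n) (g x) = g ((f ^^ n) x)" "(g ^^ n) (f x) = f ((g ^^ n) x)" for n x
    by (induction n) (simp_all add: comm)
  have "G ((s ^^ n) x)" if "G ((f ^^ i) x)" "G ((g ^^ j) x)" "n = i + j" for n
    using that
  proof (induction n arbitrary: x i j)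
    case (Suc n)
    show ?case
    proof (cases i)
      case 0
      then show ?thesis using Suc.prems s_G[of x "Suc n"] by simp
    next
      case i: (Suc i')
      show ?thesis
      proof (cases j)
        case 0
        then show ?thesis using Suc.prems s_G[of x "Suc n"] by simp
      next
        case j: (Suc j')
        \<comment> \<open>In the first summand the exponent of f drops by one and, by commutation,
          that of g is kept; in the second it is the reverse. This replaces the binomial
          formula.\<close>
        have "(s ^^ Suc n) x = (s ^^ n) (f x) + (s ^^ n) (g x)"
          by (simp only: funpow_Suc_right o_apply s_step s_add)
        moreover have "G ((s ^^ n) (f x))"
          using Suc.prems i by (intro Suc.IH[of i' _ j]) (simp_all add: funpow_swap1 pow_comm G)
        moreover have "G ((s ^^ n) (g x))"
          using Suc.prems j by (intro Suc.IH[of i _ j']) (simp_all add: funpow_swap1 pow_comm G)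
        ultimately show ?thesis by (simp add: G)
      qed
    qed
  qed simp
  then show ?thesis using assms(7,8) by (simp add: s_def)
qed

text \<open>f acts nilpotently on H modulo a smaller filtration step G.\<close>

definition nilop :: "('v::ab_group_add \<Rightarrow> bool) \<Rightarrow> ('v \<Rightarrow> bool) \<Rightarrow> ('v \<Rightarrow> 'v) \<Rightarrow> bool" where
  "nilop H G f \<longleftrightarrow> (\<forall>x y. f (x + y) = f x + f y) \<and> (\<forall>x. H x \<longrightarrow> H (f x)) \<and> (\<forall>x. G x \<longrightarrow> G (f x))
     \<and> (\<exists>m. \<forall>x. H x \<longrightarrow> G ((f ^^ m) x))"

lemma nilop_add:
  assumes f: "nilop H G f" and g: "nilop H G g"
    and comm: "\<And>x. f (g x) = g (f x)"
    and G: "\<And>x y. G x \<Longrightarrow> G y \<Longrightarrow> G (x + y)" and H: "\<And>x y. H x \<Longrightarrow> H y \<Longrightarrow> H (x + y)"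
  shows "nilop H G (\<lambda>x. f x + g x)"
proof -
  obtain i j where i: "\<And>x. H x \<Longrightarrow> G ((f ^^ i) x)" and j: "\<And>x. H x \<Longrightarrow> G ((g ^^ j) x)"
    using f g by (auto simp: nilop_def)
  have "G (((\<lambda>x. f x + g x) ^^ (i + j)) x)" if "H x" for x
    by (rule funpow_add_op_mod) (use f g comm G i[OF that] j[OF that] in \<open>auto simp: nilop_def\<close>)
  then show ?thesis
    using f g G H unfolding nilop_def by (auto simp: algebra_simps)
qed

lemma nilop_sum:
  fixes F :: "'i \<Rightarrow> 'v::ab_group_add \<Rightarrow> 'v"
  assumes "finite A" "\<And>a. a \<in> A \<Longrightarrow> nilop H G (F a)"
    and "\<And>a b x. a \<in> A \<Longrightarrow> b \<in> A \<Longrightarrow> a \<noteq> b \<Longrightarrow> F a (F b x) = F b (F a x)"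
    and G: "G 0" "\<And>x y. G x \<Longrightarrow> G y \<Longrightarrow> G (x + y)" and H: "H 0" "\<And>x y. H x \<Longrightarrow> H y \<Longrightarrow> H (x + y)"
  shows "nilop H G (\<lambda>x. \<Sum>a\<in>A. F a x)"
  using assms(1-3)
proof (induction A rule: finite_induct)
  case empty
  have "\<exists>m. \<forall>x. H x \<longrightarrow> G (((\<lambda>x. 0) ^^ m) x)"
    by (rule exI[of _ 1]) (simp add: G)
  then show ?case by (simp add: nilop_def G H)
next
  case (insert a A)
  have add: "F a (x + y) = F a x + F a y" for x y
    using insert.prems(1)[of a] by (simp add: nilop_def)
  have zero: "F a 0 = 0" using add[of 0 0] by simp
  have sum: "F a (\<Sum>b\<in>B. f b) = (\<Sum>b\<in>B. F a (f b))" for B and f :: "'i \<Rightarrow> 'v"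
    by (induction B rule: infinite_finite_induct) (simp_all add: add zero)
  have "F a (\<Sum>b\<in>A. F b x) = (\<Sum>b\<in>A. F b (F a x))" for x
    unfolding sum by (rule sum.cong) (use insert in auto)
  then have "nilop H G (\<lambda>x. F a x + (\<Sum>b\<in>A. F b x))"
    using insert by (intro nilop_add) (auto simp: G H)
  then show ?case using insert.hyps by simp
qed

section \<open>The linear nilpotent part acting on coefficients and on single tensor slots\<close>

abbreviation mat_pow :: "('n::finite \<Rightarrow> 'n \<Rightarrow> complex) \<Rightarrow> nat \<Rightarrow> 'n \<Rightarrow> 'n \<Rightarrow> complex" where
  "mat_pow N j \<equiv> (mat_mult N ^^ j) mat_id"

lemma sum_mat_id_left:
  fixes F :: "'n::finite \<Rightarrow> 'n mps"
  shows "(\<Sum>k\<in>UNIV. mps_const (mat_id i k) \<odot> F k) = F i"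
proof -
  have "(\<Sum>k\<in>UNIV. mps_const (mat_id i k) \<odot> F k) = (\<Sum>k\<in>UNIV. if i = k then F k else 0)"
    by (rule sum.cong) (auto simp: mat_id_def)
  then show ?thesis by simp
qed

lemma sum_mat_id_right:
  fixes F :: "'n::finite \<Rightarrow> 'n mps"
  shows "(\<Sum>k\<in>UNIV. mps_const (mat_id k i) \<odot> F k) = F i"
  using sum_mat_id_left[of i F] by (simp add: mat_id_def eq_commute)

lemma sum_mat_mult:
  fixes F :: "'n::finite \<Rightarrow> 'n mps"
  shows "(\<Sum>k\<in>UNIV. mps_const (A i k) \<odot> (\<Sum>l\<in>UNIV. mps_const (B k l) \<odot> F l))
     = (\<Sum>l\<in>UNIV. mps_const (mat_mult A B i l) \<odot> F l)"
proof -
  have const_sum: "mps_const (\<Sum>k\<in>K. f k) = (\<Sum>k\<in>K. mps_const (f k))" for K and f :: "'n \<Rightarrow> complex"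
    by (rule ext) (simp add: sum_fun_apply mps_const_def)
  have "(\<Sum>k\<in>UNIV. mps_const (A i k) \<odot> (\<Sum>l\<in>UNIV. mps_const (B k l) \<odot> F l))
      = (\<Sum>k\<in>UNIV. \<Sum>l\<in>UNIV. mps_const (A i k * B k l) \<odot> F l)"
    by (simp add: mps_mult_sum_right mps_const_mult flip: mps_mult_assoc)
  also have "\<dots> = (\<Sum>l\<in>UNIV. \<Sum>k\<in>UNIV. mps_const (A i k * B k l) \<odot> F l)"
    by (rule sum.swap)
  finally show ?thesis by (simp add: mat_mult_def const_sum mps_mult_sum_left)
qed

lemma mat_nilpotent_uminus: "mat_nilpotent N \<Longrightarrow> mat_nilpotent (\<lambda>i j. - N i j)"
proof -
  have "mat_pow (\<lambda>i j. - N i j) m = (\<lambda>i j. (-1) ^ m * mat_pow N m i j)" for m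
    by (induction m) (auto simp: mat_mult_def fun_eq_iff sum_distrib_left sum_negf algebra_simps)
  then show "mat_nilpotent N \<Longrightarrow> ?thesis" by (auto simp: mat_nilpotent_def fun_eq_iff)
qed

text \<open>Acting on one slot at a time makes the operators for different slots commute, and makes
  powers of the operator powers of the matrix. With the matrix \<open>- N\<close> this is the
  contribution of one upper index to the Lie derivative along \<open>lin_vf N\<close>.\<close>

definition upper_op :: "('n::finite \<Rightarrow> 'n \<Rightarrow> complex) \<Rightarrow> nat \<Rightarrow> 'n tensor \<Rightarrow> 'n tensor" where
  "upper_op M a T = (\<lambda>us ls. \<Sum>k\<in>UNIV. mps_const (M (us ! a) k) \<odot> T (us[a := k]) ls)"

definition lower_op :: "('n::finite \<Rightarrow> 'n \<Rightarrow> complex) \<Rightarrow> nat \<Rightarrow> 'n tensor \<Rightarrow> 'n tensor" where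
  "lower_op M b T = (\<lambda>us ls. \<Sum>k\<in>UNIV. mps_const (M k (ls ! b)) \<odot> T us (ls[b := k]))"

lemma upper_op_commute:
  assumes "a \<noteq> a'"
  shows "upper_op M a (upper_op M a' T) = upper_op M a' (upper_op M a T)"
proof (intro ext)
  fix us ls \<alpha>
  have "upper_op M a (upper_op M a' T) us ls = (\<Sum>k\<in>UNIV. \<Sum>l\<in>UNIV.
      mps_const (M (us ! a) k) \<odot> (mps_const (M (us ! a') l) \<odot> T (us[a := k, a' := l]) ls))"
    using assms by (simp add: upper_op_def mps_mult_sum_right)
  also have "\<dots> = (\<Sum>l\<in>UNIV. \<Sum>k\<in>UNIV.
      mps_const (M (us ! a') l) \<odot> (mps_const (M (us ! a) k) \<odot> T (us[a' := l, a := k]) ls))"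
    by (subst sum.swap) (simp only: mps_mult_left_commute list_update_swap[OF assms])
  also have "\<dots> = upper_op M a' (upper_op M a T) us ls"
    using assms by (simp add: upper_op_def mps_mult_sum_right)
  finally show "upper_op M a (upper_op M a' T) us ls \<alpha> = upper_op M a' (upper_op M a T) us ls \<alpha>"
    by simp
qed

lemma lower_op_commute:
  assumes "b \<noteq> b'"
  shows "lower_op M b (lower_op M b' T) = lower_op M b' (lower_op M b T)"
proof (intro ext)
  fix us ls \<alpha>
  have "lower_op M b (lower_op M b' T) us ls = (\<Sum>k\<in>UNIV. \<Sum>l\<in>UNIV.
      mps_const (M k (ls ! b)) \<odot> (mps_const (M l (ls ! b')) \<odot> T us (ls[b := k, b' := l])))"
    using assms by (simp add: lower_op_def mps_mult_sum_right)
  also have "\<dots> = (\<Sum>l\<in>UNIV. \<Sum>k\<in>UNIV.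
      mps_const (M l (ls ! b')) \<odot> (mps_const (M k (ls ! b)) \<odot> T us (ls[b' := l, b := k])))"
    by (subst sum.swap) (simp only: mps_mult_left_commute list_update_swap[OF assms])
  also have "\<dots> = lower_op M b' (lower_op M b T) us ls"
    using assms by (simp add: lower_op_def mps_mult_sum_right)
  finally show "lower_op M b (lower_op M b' T) us ls \<alpha> = lower_op M b' (lower_op M b T) us ls \<alpha>"
    by simp
qed

lemma upper_lower_op_commute: "upper_op M a (lower_op M' b T) = lower_op M' b (upper_op M a T)"
  by (simp add: upper_op_def lower_op_def mps_mult_sum_right mps_mult_left_commute)
     (subst sum.swap, rule refl)

lemma upper_op_funpow:
  assumes "a < length us"
  shows "(upper_op M a ^^ j) T us ls = (\<Sum>k\<in>UNIV. mps_const (mat_pow M j (us ! a) k) \<odot> T (us[a := k]) ls)"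
  using assms
proof (induction j arbitrary: us)
  case 0
  then show ?case by (simp add: sum_mat_id_left)
next
  case (Suc j)
  then show ?case
    using sum_mat_mult[of M "us ! a" "mat_pow M j" "\<lambda>k. T (us[a := k]) ls"]
    by (simp add: upper_op_def)
qed

lemma lower_op_funpow:
  assumes "b < length ls"
  shows "(lower_op M b ^^ j) T us ls = (\<Sum>k\<in>UNIV. mps_const (mat_pow M j k (ls ! b)) \<odot> T us (ls[b := k]))"
  using assms
proof (induction j arbitrary: T)
  case 0
  then show ?case by (simp add: sum_mat_id_right)
next
  case (Suc j)
  \<comment> \<open>Lower indices use the transposed matrix, so the innermost application is split
    off; then the new factor stands on the left of \<open>mat_pow M j\<close>, as in the
    recursion.\<close>
  have "(lower_op M b ^^ Suc j) T us ls
     = (\<Sum>k\<in>UNIV. mps_const (mat_pow M j k (ls ! b)) \<odot> lower_op M b T us (ls[b := k]))"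
    using Suc by (simp add: funpow_Suc_right del: funpow.simps)
  also have "\<dots> = (\<Sum>k\<in>UNIV. mps_const (mat_pow M j k (ls ! b)) \<odot>
      (\<Sum>l\<in>UNIV. mps_const (M l k) \<odot> T us (ls[b := l])))"
    using Suc.prems by (simp add: lower_op_def)
  also have "\<dots> = (\<Sum>l\<in>UNIV. mps_const (mat_pow M (Suc j) l (ls ! b)) \<odot> T us (ls[b := l]))"
    using sum_mat_mult[of "\<lambda>i k. mat_pow M j k i" "ls ! b" "\<lambda>k l. M l k" "\<lambda>l. T us (ls[b := l])"]
    by (simp add: mat_mult_def mult.commute)
  finally show ?case .
qed

lemma nilop_upper_op:
  assumes "mat_nilpotent M" "a < p"
  shows "nilop (tord p q d) (tord p q (Suc d)) (upper_op M a)"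
  unfolding nilop_def
proof (intro conjI allI impI)
  show "upper_op M a (S + T) = upper_op M a S + upper_op M a T" for S T
    by (intro ext) (simp add: upper_op_def mps_distribs sum.distrib)
  have pres: "tord p q r (upper_op M a T)" if "tord p q r T" for r T
    using that by (auto simp: tord_def upper_op_def intro!: mord_sum mord_mult_right)
  show "tord p q d (upper_op M a T)" if "tord p q d T" for T
    by (rule pres[OF that])
  show "tord p q (Suc d) (upper_op M a T)" if "tord p q (Suc d) T" for T
    by (rule pres[OF that])
  show "\<exists>m. \<forall>T. tord p q d T \<longrightarrow> tord p q (Suc d) ((upper_op M a ^^ m) T)"
  proof -
    obtain m where "mat_pow M m = (\<lambda>_ _. 0)" using assms by (auto simp: mat_nilpotent_def)
    then have "tord p q (Suc d) ((upper_op M a ^^ m) T)" for T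
      using assms(2) by (auto simp: tord_def upper_op_funpow)
    then show ?thesis by blast
  qed
qed

lemma nilop_lower_op:
  assumes "mat_nilpotent M" "b < q"
  shows "nilop (tord p q d) (tord p q (Suc d)) (lower_op M b)"
  unfolding nilop_def
proof (intro conjI allI impI)
  show "lower_op M b (S + T) = lower_op M b S + lower_op M b T" for S T
    by (intro ext) (simp add: lower_op_def mps_distribs sum.distrib)
  have pres: "tord p q r (lower_op M b T)" if "tord p q r T" for r T
    using that by (auto simp: tord_def lower_op_def intro!: mord_sum mord_mult_right)
  show "tord p q d (lower_op M b T)" if "tord p q d T" for T
    by (rule pres[OF that])
  show "tord p q (Suc d) (lower_op M b T)" if "tord p q (Suc d) T" for T
    by (rule pres[OF that])
  show "\<exists>m. \<forall>T. tord p q d T \<longrightarrow> tord p q (Suc d) ((lower_op M b ^^ m) T)"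
  proof -
    obtain m where "mat_pow M m = (\<lambda>_ _. 0)" using assms by (auto simp: mat_nilpotent_def)
    then have "tord p q (Suc d) ((lower_op M b ^^ m) T)" for T
      using assms(2) by (auto simp: tord_def lower_op_funpow)
    then show ?thesis by blast
  qed
qed

definition lin_vf :: "('n::finite \<Rightarrow> 'n \<Rightarrow> complex) \<Rightarrow> 'n vf" where
  "lin_vf N i = (\<Sum>l\<in>UNIV. mps_const (N i l) \<odot> mps_var l)"

lemma mps_deriv_lin_vf: "mps_deriv k (lin_vf N i) = mps_const (N i k)"
proof -
  have "mps_deriv k (lin_vf N i) = (\<Sum>l\<in>UNIV. if k = l then mps_const (N i l) else 0)"
    unfolding lin_vf_def mps_deriv_sum mps_deriv_const_mult mps_deriv_var by (rule sum.cong) auto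
  then show ?thesis by simp
qed

lemma mord_lin_vf: "mord (Suc 0) (lin_vf N i)"
  unfolding lin_vf_def
  by (intro mord_sum mord_mult_right) (auto simp: mord_1_iff mps_var_def fun_eq_iff)

text \<open>A linear field has a constant Jacobian, so its Lie derivative is a sum of commuting
  operators: the derivation of the coefficients and one matrix contraction for each slot.\<close>

lemma lie_tensor_lin_vf:
  "lie_tensor p q (lin_vf N) T = (\<lambda>us ls. vf_apply (lin_vf N) (T us ls))
     + (\<Sum>a<p. upper_op (\<lambda>i j. - N i j) a T) + (\<Sum>b<q. lower_op N b T)"
proof -
  have neg: "mps_const (- c) = - mps_const c" for c :: complex
    by (rule ext) (simp add: mps_const_def)
  show ?thesis
    by (intro ext) (simp add: lie_tensor_alt mps_deriv_lin_vf upper_op_def lower_op_def sum_fun_apply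
        neg mps_mult_uminus_left sum_negf)
qed

lemma vf_apply_funpow_sum:
  "(vf_apply V ^^ m) (\<Sum>i\<in>A. mps_const (c i) \<odot> f i) = (\<Sum>i\<in>A. mps_const (c i) \<odot> (vf_apply V ^^ m) (f i))"
  by (induction m) (simp_all add: vf_apply_sum vf_apply_const_mult)

text \<open>Local nilpotency of a derivation passes to products: by the Leibniz rule each
  application uses up one of the two exponents, and an exponent 0 means that the factor itself is
  zero.\<close>

lemma vf_apply_funpow_mult_eq_0:
  assumes "(vf_apply V ^^ i) f = 0" "(vf_apply V ^^ j) g = 0"
  shows "(vf_apply V ^^ (i + j)) (f \<odot> g) = 0"
proof -
  have pow_add: "(vf_apply V ^^ n) (f + g) = (vf_apply V ^^ n) f + (vf_apply V ^^ n) g" for n f g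
    by (induction n) (simp_all only: funpow.simps o_apply id_apply vf_apply_add)
  have pow_0: "(vf_apply V ^^ n) 0 = 0" for n
    by (induction n) (simp_all only: funpow.simps o_apply id_apply vf_apply_0)
  have "(vf_apply V ^^ n) (f \<odot> g) = 0"
    if "(vf_apply V ^^ i) f = 0" "(vf_apply V ^^ j) g = 0" "n = i + j" for n
    using that
  proof (induction n arbitrary: f g i j)
    case (Suc n)
    show ?case
    proof (cases "i = 0 \<or> j = 0")
      case True
      then have "f = 0 \<or> g = 0" using Suc.prems by (metis funpow_0)
      then have "f \<odot> g = 0" by (metis mps_mult_zero)
      then show ?thesis by (metis pow_0)
    next
      case False
      then obtain i' j' where ij: "i = Suc i'" "j = Suc j'" by (metis not0_implies_Suc)
      have "(vf_apply V ^^ n) (vf_apply V f \<odot> g) = 0"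
        using Suc.prems ij by (intro Suc.IH[of i' _ j]) (simp_all add: funpow_swap1)
      moreover have "(vf_apply V ^^ n) (f \<odot> vf_apply V g) = 0"
        using Suc.prems ij by (intro Suc.IH[of i _ j']) (simp_all add: funpow_swap1)
      ultimately show ?thesis
        by (simp add: funpow_Suc_right vf_apply_mult pow_add del: funpow.simps)
    qed
  qed auto
  then show ?thesis using assms by simp
qed

definition mps_monom :: "('n \<Rightarrow> nat) \<Rightarrow> 'n mps" where
  "mps_monom \<alpha> = (\<lambda>\<beta>. if \<beta> = \<alpha> then 1 else 0)"

text \<open>On the variables the field acts as the matrix N, hence nilpotently; monomials are
  products of variables, so induction on the degree applies.\<close>

lemma lin_vf_nilpotent_monom:
  assumes N: "mat_nilpotent N"
  shows "\<exists>m. (vf_apply (lin_vf N) ^^ m) (mps_monom \<alpha>) = 0"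
proof (induction "sum \<alpha> UNIV" arbitrary: \<alpha>)
  case 0
  then have "mps_monom \<alpha> = mps_const 1" by (simp add: mps_monom_def mps_const_def fun_eq_iff)
  then have "(vf_apply (lin_vf N) ^^ 1) (mps_monom \<alpha>) = 0" by simp
  then show ?case ..
next
  case (Suc n)
  have var: "(vf_apply (lin_vf N) ^^ m) (mps_var i) = (\<Sum>l\<in>UNIV. mps_const (mat_pow N m i l) \<odot> mps_var l)"
    for m i
  proof (induction m arbitrary: i)
    case 0
    then show ?case by (simp add: sum_mat_id_left)
  next
    case (Suc m)
    have "vf_apply (lin_vf N) (mps_var i) = (\<Sum>k\<in>UNIV. if k = i then lin_vf N k else 0)"
      unfolding vf_apply_alt mps_deriv_var by (rule sum.cong) auto
    then have "vf_apply (lin_vf N) (mps_var i) = lin_vf N i" by simp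
    then have "(vf_apply (lin_vf N) ^^ Suc m) (mps_var i)
        = (\<Sum>l\<in>UNIV. mps_const (N i l) \<odot> (vf_apply (lin_vf N) ^^ m) (mps_var l))"
      by (simp add: funpow_Suc_right vf_apply_funpow_sum lin_vf_def[of N i] del: funpow.simps)
    then show ?case using Suc sum_mat_mult[of N i "mat_pow N m" mps_var] by simp
  qed
  from Suc.hyps(2) obtain i where i: "\<alpha> i \<noteq> 0" by (metis nat.distinct(1) sum.neutral)
  define \<beta> where "\<beta> = \<alpha>(i := \<alpha> i - 1)"
  have "\<alpha> = \<beta> + unit_idx i" using i by (auto simp: \<beta>_def fun_eq_iff)
  then have "sum \<alpha> UNIV = sum \<beta> UNIV + 1" by (simp add: sum.distrib)
  with Suc.hyps obtain m where m: "(vf_apply (lin_vf N) ^^ m) (mps_monom \<beta>) = 0" by force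
  obtain k where "mat_pow N k = (\<lambda>_ _. 0)" using N by (auto simp: mat_nilpotent_def)
  then have "(vf_apply (lin_vf N) ^^ k) (mps_var i) = 0" by (simp add: var)
  from vf_apply_funpow_mult_eq_0[OF this m]
  have "(vf_apply (lin_vf N) ^^ (k + m)) (mps_var i \<odot> mps_monom \<beta>) = 0" .
  moreover have "mps_var i \<odot> mps_monom \<beta> = mps_monom \<alpha>"
  proof
    fix \<delta>
    have "\<delta> i \<noteq> 0 \<and> \<delta>(i := \<delta> i - 1) = \<beta> \<longleftrightarrow> \<delta> = \<alpha>"
      using i unfolding \<beta>_def by (metis fun_upd_idem_iff fun_upd_same fun_upd_upd Suc_pred' not_gr0 diff_Suc_1)
    then show "(mps_var i \<odot> mps_monom \<beta>) \<delta> = mps_monom \<alpha> \<delta>"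
      by (auto simp: mps_mult_var_left mps_monom_def)
  qed
  ultimately show ?case by metis
qed

text \<open>The exponent must not depend on f. Modulo order d + 1 only the finitely many monomials
  of degree d matter, and the sum of their exponents bounds each of them.\<close>

lemma lin_vf_nilpotent_mord:
  assumes N: "mat_nilpotent N"
  shows "\<exists>m. \<forall>f. mord d f \<longrightarrow> mord (Suc d) ((vf_apply (lin_vf N) ^^ m) f)"
proof -
  let ?V = "vf_apply (lin_vf N)"
  define S where "S = {\<alpha> :: 'a \<Rightarrow> nat. sum \<alpha> UNIV = d}"
  have "finite S"
    by (rule finite_subset[OF _ finite_multiindex_degree_less[of "Suc d"]]) (auto simp: S_def)
  have pow_0: "(?V ^^ n) 0 = 0" for n
    by (induction n) (simp_all only: funpow.simps o_apply id_apply vf_apply_0)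
  obtain \<mu> where \<mu>: "\<And>\<alpha>. (?V ^^ \<mu> \<alpha>) (mps_monom \<alpha>) = 0"
    using lin_vf_nilpotent_monom[OF N] by metis
  define m where "m = (\<Sum>\<alpha>\<in>S. \<mu> \<alpha>)"
  have m: "(?V ^^ m) (mps_monom \<alpha>) = 0" if "\<alpha> \<in> S" for \<alpha>
  proof -
    have "\<mu> \<alpha> \<le> m" unfolding m_def using \<open>finite S\<close> that by (intro member_le_sum) auto
    then have "(?V ^^ m) (mps_monom \<alpha>) = (?V ^^ (m - \<mu> \<alpha>)) ((?V ^^ \<mu> \<alpha>) (mps_monom \<alpha>))"
      by (metis funpow_add o_apply le_add_diff_inverse2)
    then show ?thesis by (simp add: \<mu> pow_0)
  qed
  have "mord (Suc d) ((?V ^^ m) f)" if f: "mord d f" for f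
  proof -
    \<comment> \<open>The homogeneous part of f of degree d; it is annihilated, and the rest keeps
      order d + 1.\<close>
    define h where "h = (\<Sum>\<alpha>\<in>S. mps_const (f \<alpha>) \<odot> mps_monom \<alpha>)"
    have "(mps_const (f \<alpha>) \<odot> mps_monom \<alpha>) \<beta> = (if \<alpha> = \<beta> then f \<beta> else 0)" for \<alpha> \<beta>
      by (simp add: mps_mult_const_left mps_monom_def)
    then have "h \<beta> = (if \<beta> \<in> S then f \<beta> else 0)" for \<beta>
      using \<open>finite S\<close> by (simp add: h_def sum_fun_apply)
    then have fh: "mord (Suc d) (f - h)"
      using f by (auto simp: mord_def S_def less_Suc_eq)
    have pow_add: "(?V ^^ n) (f + g) = (?V ^^ n) f + (?V ^^ n) g" for n f g
      by (induction n) (simp_all only: funpow.simps o_apply id_apply vf_apply_add)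
    have "mord (Suc d) ((?V ^^ n) g)" if "mord (Suc d) g" for n g
      using that mord_vf_apply[OF mord_lin_vf[of N]] by (induction n) auto
    moreover have "(?V ^^ m) h = 0"
      by (simp add: h_def vf_apply_funpow_sum m)
    then have "(?V ^^ m) f = (?V ^^ m) (f - h)"
      using pow_add[of m "f - h" h] by simp
    ultimately show ?thesis using fh by simp
  qed
  then show ?thesis by blast
qed

text \<open>The derivation of the coefficients gains order by nilpotency on monomials, the slot
  operators because a power of N vanishes. All of them commute, so their sum inherits nilpotency
  modulo the next order.\<close>

lemma nilop_lie_lin_vf:
  assumes N: "mat_nilpotent N"
  shows "nilop (tord p q d) (tord p q (Suc d)) (lie_tensor p q (lin_vf N))"
proof -
  define V :: "'a tensor \<Rightarrow> 'a tensor" where "V = (\<lambda>T us ls. vf_apply (lin_vf N) (T us ls))"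
  define U where "U = upper_op (\<lambda>i j. - N i j)"
  have V_pow: "(V ^^ m) T us ls = (vf_apply (lin_vf N) ^^ m) (T us ls)" for m T us ls
    by (induction m) (simp_all add: V_def)
  have V: "nilop (tord p q d) (tord p q (Suc d)) V"
    unfolding nilop_def
  proof (intro conjI allI impI)
    show "V (S + T) = V S + V T" for S T
      by (intro ext) (simp add: V_def vf_apply_add)
    have pres: "tord p q r (V T)" if "tord p q r T" for r T
      using that mord_vf_apply[OF mord_lin_vf[of N], where r = r] by (simp add: tord_def V_def)
    show "tord p q d (V T)" if "tord p q d T" for T
      by (rule pres[OF that])
    show "tord p q (Suc d) (V T)" if "tord p q (Suc d) T" for T
      by (rule pres[OF that])
    show "\<exists>m. \<forall>T. tord p q d T \<longrightarrow> tord p q (Suc d) ((V ^^ m) T)"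
    proof -
      obtain m where "\<forall>f. mord d f \<longrightarrow> mord (Suc d) ((vf_apply (lin_vf N) ^^ m) f)"
        using lin_vf_nilpotent_mord[OF N] by blast
      then have "tord p q d T \<longrightarrow> tord p q (Suc d) ((V ^^ m) T)" for T
        by (simp add: tord_def V_pow)
      then show ?thesis by blast
    qed
  qed
  have VU: "V (U a T) = U a (V T)" for a T
    by (simp add: V_def U_def upper_op_def vf_apply_sum vf_apply_const_mult)
  have VL: "V (lower_op N b T) = lower_op N b (V T)" for b T
    by (simp add: V_def lower_op_def vf_apply_sum vf_apply_const_mult)
  have V_sum: "V (\<Sum>i\<in>I. F i) = (\<Sum>i\<in>I. V (F i))" for I :: "nat set" and F
    by (intro ext) (simp add: V_def sum_fun_apply vf_apply_sum)
  have U_sum: "U a (\<Sum>i\<in>I. F i) = (\<Sum>i\<in>I. U a (F i))" for a and I :: "nat set" and F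
    by (intro ext, simp add: U_def upper_op_def sum_fun_apply mps_mult_sum_right, subst sum.swap) (rule refl)
  have L_sum: "lower_op N b (\<Sum>i\<in>I. F i) = (\<Sum>i\<in>I. lower_op N b (F i))" for b and I :: "nat set" and F
    by (intro ext, simp add: lower_op_def sum_fun_apply mps_mult_sum_right, subst sum.swap) (rule refl)
  have L_add: "lower_op N b (S + T) = lower_op N b S + lower_op N b T" for b S T
    by (intro ext) (simp add: lower_op_def mps_distribs sum.distrib)
  have U: "nilop (tord p q d) (tord p q (Suc d)) (\<lambda>T. \<Sum>a<p. U a T)"
    using N by (intro nilop_sum) (auto simp: U_def mat_nilpotent_uminus intro: nilop_upper_op upper_op_commute tord_add)
  have L: "nilop (tord p q d) (tord p q (Suc d)) (\<lambda>T. \<Sum>b<q. lower_op N b T)"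
    using N by (intro nilop_sum) (auto intro: nilop_lower_op lower_op_commute tord_add)
  have "nilop (tord p q d) (tord p q (Suc d)) (\<lambda>T. V T + (\<Sum>a<p. U a T) + (\<Sum>b<q. lower_op N b T))"
  proof (intro nilop_add V U L tord_add)
    show "V (\<Sum>a<p. U a T) = (\<Sum>a<p. U a (V T))" for T
      by (simp only: V_sum VU)
    fix T
    have "V (\<Sum>b<q. lower_op N b T) = (\<Sum>b<q. lower_op N b (V T))"
      by (simp only: V_sum VL)
    moreover have "(\<Sum>a<p. U a (\<Sum>b<q. lower_op N b T)) = (\<Sum>b<q. lower_op N b (\<Sum>a<p. U a T))"
      by (simp only: U_sum L_sum) (simp add: U_def upper_lower_op_commute sum.swap[of _ "{..<p}"])
    ultimately show "V (\<Sum>b<q. lower_op N b T) + (\<Sum>a<p. U a (\<Sum>b<q. lower_op N b T))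
        = (\<Sum>b<q. lower_op N b (V T + (\<Sum>a<p. U a T)))"
      by (simp only: L_add sum.distrib)
  qed
  moreover have "lie_tensor p q (lin_vf N) T = V T + (\<Sum>a<p. U a T) + (\<Sum>b<q. lower_op N b T)" for T
    by (simp only: lie_tensor_lin_vf V_def U_def)
  ultimately show ?thesis by presburger
qed

section \<open>Polynomials in the twisted Lie derivative\<close>

locale linear_operator = vector_space scale
  for scale :: "complex \<Rightarrow> 'v::ab_group_add \<Rightarrow> 'v" +
  fixes D :: "'v \<Rightarrow> 'v"
  assumes D_add: "D (x + y) = D x + D y" and D_scale: "D (scale c x) = scale c (D x)"
begin

text \<open>The Horner scheme for P(D) x.\<close>

definition poly_op :: "complex poly \<Rightarrow> 'v \<Rightarrow> 'v" where
  "poly_op P x = fold_coeffs (\<lambda>c y. scale c x + D y) P 0"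

lemma D_0 [simp]: "D 0 = 0"
  using D_add[of 0 0] by simp

lemma poly_op_0 [simp]: "poly_op 0 x = 0"
  by (simp add: poly_op_def)

lemma poly_op_pCons: "poly_op (pCons c P) x = scale c x + D (poly_op P x)"
  by (cases "c = 0 \<and> P = 0") (auto simp: poly_op_def)

lemma poly_op_add_right: "poly_op P (x + y) = poly_op P x + poly_op P y"
  by (induction P) (simp_all add: poly_op_pCons D_add scale_right_distrib algebra_simps)

lemma poly_op_add_left: "poly_op (P + Q) x = poly_op P x + poly_op Q x"
  by (induction P Q rule: poly_induct2)
     (simp_all add: poly_op_pCons D_add scale_left_distrib algebra_simps)

lemma poly_op_smult: "poly_op (smult c P) x = scale c (poly_op P x)"
  by (induction P) (simp_all add: poly_op_pCons D_scale scale_right_distrib)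

lemma poly_op_mult: "poly_op (P * Q) x = poly_op P (poly_op Q x)"
  by (induction P) (simp_all add: poly_op_pCons poly_op_add_left poly_op_smult)

lemma poly_op_linear_power: "poly_op ([:- e, 1:] ^ m) x = ((\<lambda>y. D y - scale e y) ^^ m) x"
  by (induction m) (simp_all add: poly_op_mult poly_op_pCons one_pCons del: mult_pCons_left)

lemma poly_op_closed:
  assumes "K 0" "\<And>x y. K x \<Longrightarrow> K y \<Longrightarrow> K (x + y)" "\<And>c x. K x \<Longrightarrow> K (scale c x)" "\<And>x. K x \<Longrightarrow> K (D x)"
    and "K x"
  shows "K (poly_op P x)"
  using assms by (induction P) (simp_all add: poly_op_pCons)

end

text \<open>The Chinese remainder theorem for the coprime powers of the linear factors. A congruence
  modulo the m-th power, stronger than a value at e, lets P(D) ignore a nilpotent part of D.\<close>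

lemma interpolation_poly_power:
  fixes S :: "complex set"
  assumes "finite S"
  shows "\<exists>P. \<forall>e\<in>S. [:- e, 1:] ^ m dvd P - [:\<nu> e:]"
  using assms
proof (induction S rule: finite_induct)
  case empty
  then show ?case by simp
next
  case (insert \<mu> S)
  then obtain P where P: "\<forall>e\<in>S. [:- e, 1:] ^ m dvd P - [:\<nu> e:]" by blast
  define Q where "Q = (\<Prod>e\<in>S. [:- e, 1:] ^ m)"
  have Q\<mu>: "poly Q \<mu> \<noteq> 0"
    using insert.hyps by (auto simp: Q_def poly_prod)
  \<comment> \<open>T is divisible by Q and congruent to 1 modulo the m-th power of the linear factor at \<mu>.\<close>
  define R where "R = 1 - smult (1 / poly Q \<mu>) Q"
  define T where "T = 1 - R ^ m"
  have "poly R \<mu> = 0" using Q\<mu> by (simp add: R_def)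
  then have "[:- \<mu>, 1:] dvd R" by (simp add: poly_eq_0_iff_dvd)
  then have R_dvd: "[:- \<mu>, 1:] ^ m dvd R ^ m" by (rule dvd_power_same)
  have "1 - R dvd 1 - R ^ m"
    using one_diff_power_eq[of R m] by (metis dvd_triv_left)
  moreover have "Q dvd 1 - R" by (simp add: R_def dvd_smult)
  ultimately have QT: "Q dvd T" unfolding T_def by (rule dvd_trans[rotated])
  \<comment> \<open>Since T is 0 modulo Q and 1 modulo the power at \<mu>, this keeps P at the old
    points and switches to \<nu> \<mu> at the new one.\<close>
  define P' where "P' = P + ([:\<nu> \<mu>:] - P) * T"
  have "[:- e, 1:] ^ m dvd P' - [:\<nu> e:]" if "e \<in> S" for e
  proof -
    have "[:- e, 1:] ^ m dvd Q"
      unfolding Q_def using insert.hyps(1) that by (rule dvd_prodI)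
    then have "[:- e, 1:] ^ m dvd T" using QT by (rule dvd_trans)
    then have "[:- e, 1:] ^ m dvd (P - [:\<nu> e:]) + ([:\<nu> \<mu>:] - P) * T"
      using P that by (intro dvd_add dvd_mult) auto
    then show ?thesis by (simp add: P'_def algebra_simps)
  qed
  moreover have "P' - [:\<nu> \<mu>:] = (P - [:\<nu> \<mu>:]) * R ^ m"
    by (simp add: P'_def T_def algebra_simps)
  then have "[:- \<mu>, 1:] ^ m dvd P' - [:\<nu> \<mu>:]" using R_dvd by simp
  ultimately show ?case by blast
qed

lemma vector_space_tensor: "vector_space (\<lambda>c. tmul (mps_const c) :: 'n::finite tensor \<Rightarrow> 'n tensor)"
  by unfold_locales (simp_all add: tmul_add_right tmul_add_left mps_const_add tmul_tmul mps_const_mult)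

text \<open>\<open>X_resonant\<close> is the vanishing of the bracket of X with its semisimple part,
  read off in coefficients; N is the nilpotent part of the linear part.\<close>

locale pd_field =
  fixes X :: "'n::finite vf" and \<gamma> :: "'n \<Rightarrow> complex" and N :: "'n \<Rightarrow> 'n \<Rightarrow> complex"
  assumes X_resonant: "X i \<alpha> \<noteq> 0 \<Longrightarrow> dot \<gamma> \<alpha> = \<gamma> i"
    and N_nilpotent: "mat_nilpotent N"
    and X_higher: "mord 2 (X i - diag_vf \<gamma> i - lin_vf N i)"
begin

definition twisted_lie :: "'n mps \<Rightarrow> nat \<Rightarrow> nat \<Rightarrow> 'n tensor \<Rightarrow> 'n tensor" where
  "twisted_lie h p q T = lie_tensor p q X T - tmul h T"

lemma twisted_lie_add: "twisted_lie h p q (S + T) = twisted_lie h p q S + twisted_lie h p q T"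
  unfolding twisted_lie_def lie_tensor_add tmul_add_right by (rule add_diff_add)

lemma twisted_lie_tmul:
  "twisted_lie h p q (tmul f T) = tmul (vf_apply X f) T + tmul f (twisted_lie h p q T)"
  unfolding twisted_lie_def lie_tensor_tmul tmul_diff_right tmul_tmul mps_mult_commute[of h f]
  by (rule add_diff_eq[symmetric])

lemma linear_operator_twisted_lie: "linear_operator (\<lambda>c. tmul (mps_const c)) (twisted_lie h p q)"
proof (intro linear_operator.intro vector_space_tensor linear_operator_axioms.intro twisted_lie_add)
  show "twisted_lie h p q (tmul (mps_const c) T) = tmul (mps_const c) (twisted_lie h p q T)" for c T
    unfolding twisted_lie_tmul by simp
qed

abbreviation pop :: "'n mps \<Rightarrow> nat \<Rightarrow> nat \<Rightarrow> complex poly \<Rightarrow> 'n tensor \<Rightarrow> 'n tensor" where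
  "pop h p q \<equiv> linear_operator.poly_op (\<lambda>c. tmul (mps_const c)) (twisted_lie h p q)"

lemmas pop_pCons = linear_operator.poly_op_pCons[OF linear_operator_twisted_lie]
  and pop_0 = linear_operator.poly_op_0[OF linear_operator_twisted_lie]
  and pop_add_left = linear_operator.poly_op_add_left[OF linear_operator_twisted_lie]
  and pop_add_right = linear_operator.poly_op_add_right[OF linear_operator_twisted_lie]
  and pop_mult = linear_operator.poly_op_mult[OF linear_operator_twisted_lie]
  and pop_linear_power = linear_operator.poly_op_linear_power[OF linear_operator_twisted_lie]
  and pop_closed = linear_operator.poly_op_closed[OF linear_operator_twisted_lie]

lemma mord_X: "mord (Suc 0) (X i)"
proof -
  have "mord (Suc 0) (diag_vf \<gamma> i)"
    by (auto simp: mord_1_iff diag_vf_def mps_var_def fun_eq_iff)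
  then have "mord (Suc 0) ((X i - diag_vf \<gamma> i - lin_vf N i) + (diag_vf \<gamma> i + lin_vf N i))"
    using mord_mono[OF X_higher, of "Suc 0"] by (intro mord_add mord_lin_vf) auto
  moreover have "(X i - diag_vf \<gamma> i - lin_vf N i) + (diag_vf \<gamma> i + lin_vf N i) = X i"
    by (simp add: algebra_simps)
  ultimately show ?thesis by metis
qed

lemma mord_vf_apply_X: "mord r f \<Longrightarrow> mord r (vf_apply X f)"
  using mord_vf_apply[of 0 X r f] mord_X by simp

lemma tord_twisted_lie: "tord p q r T \<Longrightarrow> tord p q r (twisted_lie h p q T)"
  unfolding twisted_lie_def
  using tord_lie[of 0 X p q r T] tord_tmul[of 0 h p q r T] mord_X by (auto intro!: tord_diff)

lemma wsupp_twisted_lie: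
  assumes "\<And>\<beta>. h \<beta> \<noteq> 0 \<Longrightarrow> dot \<gamma> \<beta> = 0" "wsupp \<gamma> p q A T"
  shows "wsupp \<gamma> p q A (twisted_lie h p q T)"
  unfolding twisted_lie_def using assms X_resonant by (intro wsupp_diff wsupp_lie wsupp_tmul) auto

lemma tord_pop: "tord p q r T \<Longrightarrow> tord p q r (pop h p q P T)"
  using tord_tmul[of 0 _ p q r]
  by (intro pop_closed[where K = "tord p q r"] tord_add tord_twisted_lie) auto

lemma wsupp_pop:
  assumes "\<And>\<beta>. h \<beta> \<noteq> 0 \<Longrightarrow> dot \<gamma> \<beta> = 0" "wsupp \<gamma> p q A T"
  shows "wsupp \<gamma> p q A (pop h p q P T)"
  using assms
  by (intro pop_closed[where K = "wsupp \<gamma> p q A"] wsupp_add wsupp_twisted_lie wsupp_tmul_const) auto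

text \<open>On tensors of weight \<omega>, the only eigenvalue of the twisted derivative modulo any
  order is \<omega> minus the constant term of h; subtracting it leaves the nilpotent part.\<close>

definition shifted :: "'n mps \<Rightarrow> nat \<Rightarrow> nat \<Rightarrow> complex \<Rightarrow> 'n tensor \<Rightarrow> 'n tensor" where
  "shifted h p q \<omega> T = twisted_lie h p q T - tmul (mps_const (\<omega> - h (\<lambda>_. 0))) T"

lemma tord_shifted: "tord p q r T \<Longrightarrow> tord p q r (shifted h p q \<omega> T)"
  unfolding shifted_def
  using tord_tmul[of 0 "mps_const (\<omega> - h (\<lambda>_. 0))" p q r T] by (intro tord_diff tord_twisted_lie) auto

lemma wsupp_shifted:
  assumes "\<And>\<beta>. h \<beta> \<noteq> 0 \<Longrightarrow> dot \<gamma> \<beta> = 0" "wsupp \<gamma> p q A T"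
  shows "wsupp \<gamma> p q A (shifted h p q \<omega> T)"
  unfolding shifted_def using assms by (intro wsupp_diff wsupp_twisted_lie wsupp_tmul_const)

text \<open>The semisimple part acts as \<omega> and cancels, while the nonlinear part of X and the
  nonconstant part of h each raise the order. What remains at order d is the linear nilpotent
  field.\<close>

lemma shifted_leading:
  assumes T: "wsupp \<gamma> p q {\<omega>} T" "tord p q d T"
  shows "tord p q (Suc d) (shifted h p q \<omega> T - lie_tensor p q (lin_vf N) T)"
proof -
  define R where "R = (\<lambda>i. X i - diag_vf \<gamma> i - lin_vf N i)"
  have "X = diag_vf \<gamma> + lin_vf N + R"
    by (intro ext) (simp add: R_def)
  then have X: "lie_tensor p q X T =
      lie_tensor p q (diag_vf \<gamma>) T + lie_tensor p q (lin_vf N) T + lie_tensor p q R T"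
    by (metis lie_tensor_vf_add)
  have "lie_tensor p q (diag_vf \<gamma>) T us ls = tmul (mps_const \<omega>) T us ls"
    if "length us = p" "length ls = q" for us ls
  proof
    fix \<alpha>
    show "lie_tensor p q (diag_vf \<gamma>) T us ls \<alpha> = tmul (mps_const \<omega>) T us ls \<alpha>"
      using T(1) that by (cases "T us ls \<alpha> = 0") (auto simp: lie_tensor_diag tmul_const_apply wsupp_def)
  qed
  then have 1: "tord p q (Suc d) (lie_tensor p q (diag_vf \<gamma>) T - tmul (mps_const \<omega>) T)"
    by (simp add: tord_def mord_def)
  have 2: "tord p q (Suc d) (lie_tensor p q R T)"
    using tord_lie[of 1 R p q d T] T(2) X_higher by (simp add: R_def numeral_2_eq_2)
  have "mord (Suc 0) (h - mps_const (h (\<lambda>_. 0)))"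
    by (simp add: mord_1_iff mps_const_def)
  then have 3: "tord p q (Suc d) (tmul (h - mps_const (h (\<lambda>_. 0))) T)"
    using tord_tmul[of "Suc 0" _ p q d T] T(2) by simp
  have const_diff: "mps_const (\<omega> - h (\<lambda>_. 0)) = mps_const \<omega> - mps_const (h (\<lambda>_. 0))"
    by (rule ext) (simp add: mps_const_def)
  have "shifted h p q \<omega> T - lie_tensor p q (lin_vf N) T
    = (lie_tensor p q (diag_vf \<gamma>) T - tmul (mps_const \<omega>) T) + lie_tensor p q R T
      - tmul (h - mps_const (h (\<lambda>_. 0))) T"
    unfolding shifted_def twisted_lie_def X const_diff by (simp only: tmul_diff_left) (simp only: algebra_simps)
  with 1 2 3 show ?thesis by (metis tord_add tord_diff)
qed

text \<open>The powers of \<open>shifted\<close> and of the Lie derivative along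
  \<open>lin_vf N\<close> agree modulo the next order, by induction on the power. The exponent comes
  from the latter and is therefore the same for every \<omega>.\<close>

lemma shifted_nilpotent_step:
  assumes h: "\<And>\<beta>. h \<beta> \<noteq> 0 \<Longrightarrow> dot \<gamma> \<beta> = 0"
  shows "\<exists>m. \<forall>\<omega> T. wsupp \<gamma> p q {\<omega>} T \<longrightarrow> tord p q d T \<longrightarrow> tord p q (Suc d) ((shifted h p q \<omega> ^^ m) T)"
proof -
  let ?L = "lie_tensor p q (lin_vf N)"
  have L: "nilop (tord p q d) (tord p q (Suc d)) ?L"
    by (rule nilop_lie_lin_vf[OF N_nilpotent])
  then obtain m where m: "\<And>T. tord p q d T \<Longrightarrow> tord p q (Suc d) ((?L ^^ m) T)"
    by (auto simp: nilop_def)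
  have L_diff: "?L (S - T) = ?L S - ?L T" for S T
    using lie_tensor_add[of p q "lin_vf N" "S - T" T] by (metis add_diff_cancel_right' diff_add_cancel)
  have "tord p q (Suc d) ((shifted h p q \<omega> ^^ m) T)" if T: "wsupp \<gamma> p q {\<omega>} T" "tord p q d T" for \<omega> T
  proof -
    let ?E = "shifted h p q \<omega>"
    have E: "wsupp \<gamma> p q {\<omega>} ((?E ^^ n) T)" "tord p q d ((?E ^^ n) T)" for n
      using T by (induction n) (auto intro: wsupp_shifted tord_shifted h)
    have "tord p q (Suc d) ((?E ^^ n) T - (?L ^^ n) T)" for n
    proof (induction n)
      case (Suc n)
      have "(?E ^^ Suc n) T - (?L ^^ Suc n) T
          = (?E ((?E ^^ n) T) - ?L ((?E ^^ n) T)) + ?L ((?E ^^ n) T - (?L ^^ n) T)"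
        by (simp only: funpow.simps o_apply L_diff) (simp only: algebra_simps)
      moreover have "tord p q (Suc d) (?L ((?E ^^ n) T - (?L ^^ n) T))"
        using L Suc by (simp only: nilop_def)
      ultimately show ?case
        using shifted_leading[OF E] by (metis tord_add)
    qed (simp add: tord_def mord_def)
    from tord_add[OF this m[OF T(2)]] show ?thesis by (metis diff_add_cancel)
  qed
  then show ?thesis by blast
qed

text \<open>Climbs the order filtration one step at a time, adding the exponents; the weight is
  preserved, so each step applies to the result of the previous ones.\<close>

lemma shifted_nilpotent:
  assumes h: "\<And>\<beta>. h \<beta> \<noteq> 0 \<Longrightarrow> dot \<gamma> \<beta> = 0"
  shows "\<exists>m. \<forall>\<omega> T. wsupp \<gamma> p q {\<omega>} T \<longrightarrow> tord p q r ((shifted h p q \<omega> ^^ m) T)"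
proof (induction r)
  case (Suc r)
  then obtain m where m: "\<And>\<omega> T. wsupp \<gamma> p q {\<omega>} T \<Longrightarrow> tord p q r ((shifted h p q \<omega> ^^ m) T)"
    by blast
  obtain n where n: "\<And>\<omega> T. wsupp \<gamma> p q {\<omega>} T \<Longrightarrow> tord p q r T \<Longrightarrow> tord p q (Suc r) ((shifted h p q \<omega> ^^ n) T)"
    using shifted_nilpotent_step[OF h] by blast
  have "tord p q (Suc r) ((shifted h p q \<omega> ^^ (n + m)) T)" if T: "wsupp \<gamma> p q {\<omega>} T" for \<omega> T
  proof -
    have "wsupp \<gamma> p q {\<omega>} ((shifted h p q \<omega> ^^ m) T)"
      using T by (induction m) (auto intro: wsupp_shifted h)
    from n[OF this m[OF T]] show ?thesis by (simp add: funpow_add)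
  qed
  then show ?case by blast
qed simp

text \<open>Modulo high order, a polynomial in the twisted Lie derivative that is congruent to constants at
  the eigenvalues acts diagonally: it only sees the semisimple part.\<close>

lemma pop_diagonal:
  assumes h: "\<And>\<beta>. h \<beta> \<noteq> 0 \<Longrightarrow> dot \<gamma> \<beta> = 0"
  shows "\<exists>m. \<forall>n\<ge>m. \<forall>T us ls \<alpha> P \<nu>. length us = p \<longrightarrow> length ls = q \<longrightarrow> sum \<alpha> UNIV < r \<longrightarrow>
    [:- (wt \<gamma> p q us ls \<alpha> - h (\<lambda>_. 0)), 1:] ^ n dvd P - [:\<nu>:] \<longrightarrow> pop h p q P T us ls \<alpha> = \<nu> * T us ls \<alpha>"
proof -
  obtain m where m: "\<And>\<omega> T. wsupp \<gamma> p q {\<omega>} T \<Longrightarrow> tord p q r ((shifted h p q \<omega> ^^ m) T)"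
    using shifted_nilpotent[OF h] by blast
  have "pop h p q P T us ls \<alpha> = \<nu> * T us ls \<alpha>"
    if len: "length us = p" "length ls = q" and \<alpha>: "sum \<alpha> UNIV < r" and "m \<le> n"
      and dvd_n: "[:- (wt \<gamma> p q us ls \<alpha> - h (\<lambda>_. 0)), 1:] ^ n dvd P - [:\<nu>:]" for T us ls \<alpha> P \<nu> n
  proof -
    define \<omega> where "\<omega> = wt \<gamma> p q us ls \<alpha>"
    define e where "e = \<omega> - h (\<lambda>_. 0)"
    \<comment> \<open>Separates the weight of the coefficient under consideration. P(D) preserves
      weights, so the remainder \<open>T2\<close> contributes nothing there, and on
      \<open>T1\<close> there is a single eigenvalue e.\<close>
    define T1 where "T1 = (\<lambda>us ls \<alpha>. if wt \<gamma> p q us ls \<alpha> = \<omega> then T us ls \<alpha> else 0)"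
    define T2 where "T2 = (\<lambda>us ls \<alpha>. if wt \<gamma> p q us ls \<alpha> = \<omega> then 0 else T us ls \<alpha>)"
    have T: "T = T1 + T2" by (intro ext) (simp add: T1_def T2_def)
    have T1: "wsupp \<gamma> p q {\<omega>} T1" and T2: "wsupp \<gamma> p q (- {\<omega>}) T2"
      by (auto simp: wsupp_def T1_def T2_def)
    have "wsupp \<gamma> p q (- {\<omega>}) (pop h p q P T2)"
      by (rule wsupp_pop[OF _ T2]) (rule h)
    then have "pop h p q P T2 us ls \<alpha> = 0"
      using len by (auto simp: wsupp_def \<omega>_def)
    moreover have "pop h p q P T1 us ls \<alpha> = \<nu> * T1 us ls \<alpha>"
    proof -
      \<comment> \<open>Allowing exponents above m lets a single exponent later serve functions and
        tensors simultaneously.\<close>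
      have "[:- e, 1:] ^ m dvd P - [:\<nu>:]"
        using dvd_n power_le_dvd[OF _ \<open>m \<le> n\<close>] by (auto simp: e_def \<omega>_def)
      then obtain Q where "P - [:\<nu>:] = [:- e, 1:] ^ m * Q" by (rule dvdE)
      then have "P = [:\<nu>:] + Q * [:- e, 1:] ^ m" by (simp add: algebra_simps)
      then have "pop h p q P T1 = tmul (mps_const \<nu>) T1 + twisted_lie h p q 0
          + pop h p q Q (pop h p q ([:- e, 1:] ^ m) T1)"
        by (simp only: pop_add_left pop_mult pop_pCons pop_0)
      moreover have "twisted_lie h p q 0 = 0"
        using linear_operator.D_0[OF linear_operator_twisted_lie] .
      moreover have "pop h p q ([:- e, 1:] ^ m) T1 = (shifted h p q \<omega> ^^ m) T1"
        unfolding pop_linear_power e_def shifted_def[abs_def] ..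
      moreover have "pop h p q Q ((shifted h p q \<omega> ^^ m) T1) us ls \<alpha> = 0"
        using tord_pop[OF m[OF T1]] len \<alpha> by (simp add: tord_def mord_def)
      ultimately show ?thesis by (simp add: tmul_const_apply)
    qed
    ultimately show ?thesis
      by (simp add: T pop_add_right) (simp add: T2_def \<omega>_def)
  qed
  then show ?thesis by blast
qed

end

section \<open>The toric fields\<close>

text \<open>u is exp(v), the coefficientwise limit of the exponential sums. As v has no constant
  term, its j-th power has order at least j, so each coefficient is a finite sum.\<close>

lemma mps_exp_exists:
  fixes v :: "'n::finite mps"
  assumes v: "v (\<lambda>_. 0) = 0"
  shows "\<exists>u. u (\<lambda>_. 0) = 1 \<and> (\<forall>k. mps_deriv k u = u \<odot> mps_deriv k v)"
proof -
  define w where "w j = (((\<odot>) v) ^^ j) (mps_const 1)" for j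
  have w_Suc: "w (Suc j) = v \<odot> w j" for j by (simp add: w_def)
  have w_ord: "mord j (w j)" for j
  proof (induction j)
    case (Suc j)
    have "mord (Suc 0) v" using v by (simp add: mord_1_iff)
    from mord_mult[OF this Suc] show ?case by (simp add: w_Suc)
  qed simp
  have w_deriv: "mps_deriv k (w (Suc j)) = mps_const (of_nat (Suc j)) \<odot> (w j \<odot> mps_deriv k v)" for j k
  proof (induction j)
    case 0
    then show ?case by (simp add: w_def)
  next
    case (Suc j)
    have "mps_deriv k (w (Suc (Suc j)))
        = mps_deriv k v \<odot> w (Suc j) + v \<odot> (mps_const (of_nat (Suc j)) \<odot> (w j \<odot> mps_deriv k v))"
      unfolding w_Suc[of "Suc j"] mps_deriv_mult Suc ..
    also have "\<dots> = mps_const 1 \<odot> (w (Suc j) \<odot> mps_deriv k v)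
        + mps_const (of_nat (Suc j)) \<odot> (w (Suc j) \<odot> mps_deriv k v)"
      unfolding w_Suc by (simp only: mps_mult_ac mps_const_1_mult)
    also have "\<dots> = mps_const (1 + of_nat (Suc j)) \<odot> (w (Suc j) \<odot> mps_deriv k v)"
      by (simp only: mps_const_add mps_mult_add_left)
    finally show ?case by simp
  qed
  define E where "E M = (\<Sum>j<M. mps_const (1 / fact j) \<odot> w j)" for M
  have E_deriv: "mps_deriv k (E (Suc M)) = E M \<odot> mps_deriv k v" for M k
  proof -
    have "mps_deriv k (E (Suc M)) = (\<Sum>j<Suc M. mps_const (1 / fact j) \<odot> mps_deriv k (w j))"
      by (simp only: E_def mps_deriv_sum mps_deriv_const_mult)
    also have "\<dots> = mps_const (1 / fact 0) \<odot> mps_deriv k (w 0)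
        + (\<Sum>j<M. mps_const (1 / fact (Suc j)) \<odot> mps_deriv k (w (Suc j)))"
      by (rule sum.lessThan_Suc_shift)
    also have "mps_deriv k (w 0) = 0" by (simp add: w_def)
    also have "(\<Sum>j<M. mps_const (1 / fact (Suc j)) \<odot> mps_deriv k (w (Suc j)))
        = (\<Sum>j<M. mps_const (1 / fact j) \<odot> w j \<odot> mps_deriv k v)"
    proof (rule sum.cong)
      fix j
      have "(1 / fact (Suc j)) * of_nat (Suc j) = (1 / fact j :: complex)"
        by (simp only: fact_Suc) (simp add: field_simps del: of_nat_Suc)
      then show "mps_const (1 / fact (Suc j)) \<odot> mps_deriv k (w (Suc j))
          = mps_const (1 / fact j) \<odot> w j \<odot> mps_deriv k v"
        unfolding w_deriv mps_mult_assoc[symmetric] mps_const_mult by metis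
    qed simp
    also have "\<dots> = E M \<odot> mps_deriv k v"
      by (simp only: E_def mps_mult_sum_left)
    finally show ?thesis by simp
  qed
  \<comment> \<open>Powers v^j with j above the degree of \<alpha> do not reach this coefficient, so
    the terms up to that degree suffice.\<close>
  define u where "u \<alpha> = E (Suc (sum \<alpha> UNIV)) \<alpha>" for \<alpha>
  have "E M \<alpha> = u \<alpha>" if "sum \<alpha> UNIV < M" for M \<alpha>
    unfolding u_def E_def sum_fun_apply
  proof (rule sum.mono_neutral_right)
    show "\<forall>j\<in>{..<M} - {..<Suc (sum \<alpha> UNIV)}. (mps_const (1 / fact j) \<odot> w j) \<alpha> = 0"
      using w_ord by (auto simp: mps_mult_const_left mord_def)
  qed (use that in auto)
  then have uE: "mord M (u - E M)" for M by (simp add: mord_def)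
  have "mord M (mps_deriv k u - u \<odot> mps_deriv k v)" for M k
  proof -
    \<comment> \<open>Differentiation costs one order, so u is compared with the partial sum that
      has one term more.\<close>
    have "mps_deriv k u = mps_deriv k (u - E (Suc M)) + mps_deriv k (E (Suc M))"
      by (simp flip: mps_deriv_add)
    then have "mps_deriv k u - u \<odot> mps_deriv k v = mps_deriv k (u - E (Suc M)) - (u - E M) \<odot> mps_deriv k v"
      by (simp only: E_deriv mps_mult_diff_left) (simp only: algebra_simps)
    moreover have "mord M (mps_deriv k (u - E (Suc M)))"
      using mord_deriv[OF uE, where k = k, of "Suc M"] by (metis diff_Suc_1)
    moreover have "mord M ((u - E M) \<odot> mps_deriv k v)"
      using mord_mult_right[OF uE] by (metis mps_mult_commute)
    ultimately show ?thesis by (metis mord_diff)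
  qed
  then have "mps_deriv k u = u \<odot> mps_deriv k v" for k
    using mord_eq_zeroI by (metis eq_iff_diff_eq_0)
  moreover have "u (\<lambda>_. 0) = 1"
    by (simp add: u_def E_def w_def sum_fun_apply mps_mult_const_left) (simp add: mps_const_def)
  ultimately show ?thesis by blast
qed

definition tzero :: "nat \<Rightarrow> nat \<Rightarrow> 'n::finite tensor \<Rightarrow> bool" where
  "tzero p q T \<longleftrightarrow> (\<forall>us ls. length us = p \<longrightarrow> length ls = q \<longrightarrow> T us ls = 0)"

text \<open>The order filtration is separated: this turns identities known modulo every order into
  exact ones.\<close>

lemma tzero_iff_tord: "tzero p q T \<longleftrightarrow> (\<forall>r. tord p q r T)"
proof
  assume "\<forall>r. tord p q r T"
  then show "tzero p q T" by (auto simp: tzero_def tord_def intro: mord_eq_zeroI)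
qed (simp add: tzero_def tord_def)

lemma tzero_add: "tzero p q S \<Longrightarrow> tzero p q T \<Longrightarrow> tzero p q (S + T)"
  and tzero_diff: "tzero p q S \<Longrightarrow> tzero p q T \<Longrightarrow> tzero p q (S - T)"
  by (simp_all add: tzero_iff_tord tord_add tord_diff)

lemma tzero_tmul: "tzero p q T \<Longrightarrow> tzero p q (tmul f T)"
  using tord_tmul[of 0 f p q _ T] by (auto simp: tzero_iff_tord)

lemma tzero_tmul_cancel: "f \<noteq> 0 \<Longrightarrow> tzero p q (tmul f T) \<Longrightarrow> tzero p q T"
  unfolding tzero_def tmul_def by (metis mps_mult_eq_0_iff)

section \<open>Polynomials in X on functions, and the homological equation\<close>

context pd_field
begin

lemma tzero_twisted_lie: "tzero p q T \<Longrightarrow> tzero p q (twisted_lie h p q T)"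
  by (auto simp: tzero_iff_tord intro: tord_twisted_lie)

text \<open>P(X) f, obtained by regarding functions as tensors without indices and with zero twist,
  so that all results on \<open>pop\<close> apply.\<close>

abbreviation spop :: "complex poly \<Rightarrow> 'n mps \<Rightarrow> 'n mps" where
  "spop P f \<equiv> pop 0 0 0 P (\<lambda>_ _. f) [] []"

lemma spop_pCons: "spop (pCons c P) f = mps_const c \<odot> f + vf_apply X (spop P f)"
  by (simp add: pop_pCons twisted_lie_def tmul_def lie_tensor_alt)

lemma spop_pCons_0: "spop (pCons 0 P) f = vf_apply X (spop P f)"
  by (simp add: spop_pCons)

text \<open>X commutes with its own polynomials. This makes an approximate right inverse P(X) of X
  also a left inverse.\<close>

lemma spop_pCons_0_shift: "spop (pCons 0 P) f = spop P (vf_apply X f)"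
proof (induction P)
  case 0
  then show ?case by (simp add: spop_pCons pop_0)
next
  case (pCons c P)
  then have "vf_apply X (spop P f) = spop P (vf_apply X f)"
    by (simp only: spop_pCons_0)
  then show ?case
    unfolding spop_pCons_0[of "pCons c P"] spop_pCons[of c] vf_apply_add vf_apply_const_mult by (simp only:)
qed

lemma mord_spop: "mord r f \<Longrightarrow> mord r (spop P f)"
  using tord_pop[of 0 0 r "\<lambda>_ _. f" 0 P] by (simp add: tord_def)

lemma spop_nonresonant:
  assumes "\<And>\<alpha>. f \<alpha> \<noteq> 0 \<Longrightarrow> dot \<gamma> \<alpha> \<noteq> 0" "spop P f \<alpha> \<noteq> 0"
  shows "dot \<gamma> \<alpha> \<noteq> 0"
proof -
  have "wsupp \<gamma> 0 0 (- {0}) (\<lambda>_ _. f)"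
    using assms(1) by (auto simp: wsupp_def wt_def dot_def)
  then have "wsupp \<gamma> 0 0 (- {0}) (pop 0 0 0 P (\<lambda>_ _. f))"
    by (rule wsupp_pop[rotated]) simp
  with assms(2) show ?thesis by (auto simp: wsupp_def wt_def dot_def)
qed

lemma spop_diagonal:
  "\<exists>m. \<forall>n\<ge>m. \<forall>f \<alpha> P \<nu>. sum \<alpha> UNIV < r \<longrightarrow> [:- dot \<gamma> \<alpha>, 1:] ^ n dvd P - [:\<nu>:] \<longrightarrow> spop P f \<alpha> = \<nu> * f \<alpha>"
proof -
  obtain m where m: "\<forall>n\<ge>m. \<forall>T us ls \<alpha> P \<nu>. length us = 0 \<longrightarrow> length ls = 0 \<longrightarrow> sum \<alpha> UNIV < r \<longrightarrow>
      [:- (wt \<gamma> 0 0 us ls \<alpha> - 0 (\<lambda>_. 0)), 1:] ^ n dvd P - [:\<nu>:] \<longrightarrow> pop 0 0 0 P T us ls \<alpha> = \<nu> * T us ls \<alpha>"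
    using pop_diagonal[of 0 0 0 r] by auto
  have "spop P f \<alpha> = \<nu> * f \<alpha>" if "n \<ge> m" "sum \<alpha> UNIV < r" "[:- dot \<gamma> \<alpha>, 1:] ^ n dvd P - [:\<nu>:]" for n f \<alpha> P \<nu>
    using m[rule_format, of n "[]" "[]" \<alpha> P \<nu> "\<lambda>_ _. f"] that by (simp add: wt_def dot_def)
  then show ?thesis by blast
qed

lemma finite_dot_image: "finite (dot \<gamma> ` {\<alpha>. sum \<alpha> UNIV < r})"
  by (intro finite_imageI finite_multiindex_degree_less)

text \<open>X has nonzero eigenvalues on nonresonant series, so it is invertible there modulo order
  r, with inverse a polynomial in X. That P does not depend on f is essential for comparing
  solutions.\<close>

lemma homological_equation_mod:
  "\<exists>P. \<forall>f. (\<forall>\<alpha>. f \<alpha> \<noteq> 0 \<longrightarrow> dot \<gamma> \<alpha> \<noteq> 0) \<longrightarrow> mord r (spop (pCons 0 P) f - f)"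
proof -
  obtain m where m: "\<And>n f \<alpha> P \<nu>. n \<ge> m \<Longrightarrow> sum \<alpha> UNIV < r \<Longrightarrow> [:- dot \<gamma> \<alpha>, 1:] ^ n dvd P - [:\<nu>:] \<Longrightarrow>
      spop P f \<alpha> = \<nu> * f \<alpha>"
    using spop_diagonal[of r] by blast
  \<comment> \<open>The value 1 makes T(X) the identity on nonzero weights. The value 0 at the
    adjoined point 0, with exponent \<open>Suc m\<close> at least 1, makes T divisible by the
    variable; the quotient is P.\<close>
  define \<nu> where "\<nu> e = (if e = 0 then 0 else 1 :: complex)" for e :: complex
  obtain T where T: "\<And>e. e \<in> insert 0 (dot \<gamma> ` {\<alpha>. sum \<alpha> UNIV < r}) \<Longrightarrow> [:- e, 1:] ^ Suc m dvd T - [:\<nu> e:]"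
    using interpolation_poly_power[of "insert 0 (dot \<gamma> ` {\<alpha>. sum \<alpha> UNIV < r})" "Suc m" \<nu>]
      finite_dot_image by (meson finite_insert)
  have "[:- 0, 1:] ^ Suc m dvd T"
    using T[of 0] by (simp add: \<nu>_def)
  then have "[:- 0, 1:] dvd T"
    by (metis dvd_power dvd_trans zero_less_Suc)
  then obtain P where P: "T = pCons 0 P" by (auto elim!: dvdE)
  have "mord r (spop (pCons 0 P) f - f)" if f: "\<And>\<alpha>. f \<alpha> \<noteq> 0 \<Longrightarrow> dot \<gamma> \<alpha> \<noteq> 0" for f
    unfolding mord_def
  proof (intro allI impI)
    fix \<alpha> :: "'n \<Rightarrow> nat" assume \<alpha>: "sum \<alpha> UNIV < r"
    have "spop T f \<alpha> = \<nu> (dot \<gamma> \<alpha>) * f \<alpha>"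
      using T[of "dot \<gamma> \<alpha>"] \<alpha> by (intro m[of "Suc m"]) auto
    also have "\<dots> = f \<alpha>" using f[of \<alpha>] by (auto simp: \<nu>_def)
    finally show "(spop (pCons 0 P) f - f) \<alpha> = 0" by (simp add: P)
  qed
  then show ?thesis by blast
qed

text \<open>Modulo order r a solution is \<open>P r\<close> in X applied to b. These approximate
  solutions agree to increasing orders and hence have a coefficientwise limit.\<close>

lemma homological_equation:
  assumes b: "\<And>\<alpha>. b \<alpha> \<noteq> 0 \<Longrightarrow> dot \<gamma> \<alpha> \<noteq> 0"
  shows "\<exists>v. v (\<lambda>_. 0) = 0 \<and> vf_apply X v = b"
proof -
  obtain P where P: "\<And>r f. (\<And>\<alpha>. f \<alpha> \<noteq> 0 \<Longrightarrow> dot \<gamma> \<alpha> \<noteq> 0) \<Longrightarrow> mord r (spop (pCons 0 (P r)) f - f)"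
    using homological_equation_mod by metis
  have vf_diff: "vf_apply X (F - G) = vf_apply X F - vf_apply X G" for F G
    using vf_apply_add[of X "F - G" G] by (metis add_diff_cancel_right' diff_add_cancel)
  define w where "w r = spop (P r) b" for r
  have Xw: "mord r (vf_apply X (w r) - b)" for r
    using P[OF b] unfolding w_def spop_pCons_0 by blast
  have w_nonres: "w r \<alpha> \<noteq> 0 \<Longrightarrow> dot \<gamma> \<alpha> \<noteq> 0" for r \<alpha>
    unfolding w_def using spop_nonresonant[OF b] .
  \<comment> \<open>X sends the difference to order r, and applying \<open>P r\<close> to that image
    recovers the nonresonant difference modulo order r.\<close>
  have w_eq: "mord r (w r - w s)" if "r \<le> s" for r s
  proof -
    have "vf_apply X (w r - w s) = (vf_apply X (w r) - b) - (vf_apply X (w s) - b)"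
      by (simp add: vf_diff)
    then have "mord r (vf_apply X (w r - w s))"
      using Xw[of r] mord_mono[OF Xw[of s] that] by (metis mord_diff)
    then have 1: "mord r (spop (pCons 0 (P r)) (w r - w s))"
      unfolding spop_pCons_0_shift by (rule mord_spop)
    have "(w r - w s) \<alpha> \<noteq> 0 \<Longrightarrow> dot \<gamma> \<alpha> \<noteq> 0" for \<alpha>
      by (metis diff_self minus_apply w_nonres)
    then have 2: "mord r (spop (pCons 0 (P r)) (w r - w s) - (w r - w s))"
      by (intro P)
    have cancel: "F - (F - G) = G" for F G :: "'n mps"
      by (simp add: fun_eq_iff)
    show ?thesis
      using mord_diff[OF 1 2] unfolding cancel .
  qed
  define v where "v \<alpha> = w (Suc (sum \<alpha> UNIV)) \<alpha>" for \<alpha>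
  have vw: "mord r (v - w r)" for r
    unfolding mord_def
  proof (intro allI impI)
    fix \<alpha> :: "'n \<Rightarrow> nat" assume "sum \<alpha> UNIV < r"
    then show "(v - w r) \<alpha> = 0"
      using w_eq[of "Suc (sum \<alpha> UNIV)" r] by (simp add: v_def mord_def)
  qed
  have "mord r (vf_apply X v - b)" for r
  proof -
    have "vf_apply X v - b = vf_apply X (v - w r) + (vf_apply X (w r) - b)"
      by (simp add: vf_diff)
    then show ?thesis
      using mord_vf_apply_X[OF vw[of r]] Xw[of r] by (metis mord_add)
  qed
  then have "vf_apply X v = b"
    using mord_eq_zeroI by (metis eq_iff_diff_eq_0)
  \<comment> \<open>The zero index has weight zero, so a nonresonant series has no constant term;
    the exponential of v needs this.\<close>
  moreover have "w (Suc 0) (\<lambda>_. 0) = 0"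
  proof (rule ccontr)
    assume "w (Suc 0) (\<lambda>_. 0) \<noteq> 0"
    then have "dot \<gamma> (\<lambda>_. 0) \<noteq> 0" by (rule w_nonres)
    then show False by (simp add: dot_def)
  qed
  then have "v (\<lambda>_. 0) = 0" unfolding v_def by simp
  ultimately show ?thesis by (intro exI[of _ v] conjI)
qed

text \<open>If the twisted Lie derivative D satisfies D(\<Omega>) = (X f / f) \<Omega>, then \<Omega>/f is constant for D,
  so f P(D)\<Omega> = (P(X) f) \<Omega> for every polynomial P.\<close>

lemma pop_quotient:
  assumes f: "f \<noteq> 0"
    and eq: "tzero p q (tmul f (twisted_lie h p q \<Omega>) - tmul (vf_apply X f) \<Omega>)"
  shows "tzero p q (tmul f (pop h p q P \<Omega>) - tmul (spop P f) \<Omega>)"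
proof (induction P)
  case 0
  have "pop h p q 0 \<Omega> = 0" by (rule pop_0)
  moreover have "spop 0 f = 0" by (metis pop_0 zero_fun_apply)
  ultimately have "tmul f (pop h p q 0 \<Omega>) - tmul (spop 0 f) \<Omega> = 0"
    by (metis tmul_const_0 diff_zero)
  moreover have "tzero p q (0 :: 'n tensor)" by (simp add: tzero_def)
  ultimately show ?case by metis
next
  case (pCons c P)
  define T where "T = pop h p q P \<Omega>"
  define a where "a = spop P f"
  let ?D = "twisted_lie h p q"
  have IH: "tzero p q (tmul f T - tmul a \<Omega>)"
    using pCons unfolding T_def a_def by blast
  have D_diff: "?D (S - T) = ?D S - ?D T" for S T
    using twisted_lie_add[of h p q "S - T" T] by (metis add_diff_cancel_right' diff_add_cancel)
  \<comment> \<open>Applying D to the induction hypothesis leaves terms in X f and D \<Omega>. After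
    one more multiplication by f they are removed by the induction hypothesis and \<open>eq\<close>;
    the extra f is cancelled afterwards.\<close>
  have "tmul f (tmul f (?D T) - tmul (vf_apply X a) \<Omega>)
      = tmul f (?D (tmul f T - tmul a \<Omega>)) - tmul (vf_apply X f) (tmul f T - tmul a \<Omega>)
        + tmul a (tmul f (?D \<Omega>) - tmul (vf_apply X f) \<Omega>)"
    unfolding D_diff twisted_lie_tmul tmul_diff_right tmul_add_right tmul_tmul
    by (simp only: mps_mult_commute[of a f] mps_mult_commute[of "vf_apply X f" f]
        mps_mult_commute[of "vf_apply X f" a]) (simp only: algebra_simps)
  then have "tzero p q (tmul f (tmul f (?D T) - tmul (vf_apply X a) \<Omega>))"
    using tzero_tmul[OF tzero_twisted_lie[OF IH, of h], of f] tzero_tmul[OF IH, of "vf_apply X f"]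
      tzero_tmul[OF eq, of a] by (metis tzero_add tzero_diff)
  then have step: "tzero p q (tmul f (?D T) - tmul (vf_apply X a) \<Omega>)"
    using tzero_tmul_cancel[OF f] by blast
  have "tmul f (pop h p q (pCons c P) \<Omega>) - tmul (spop (pCons c P) f) \<Omega>
      = tmul f (?D T) - tmul (vf_apply X a) \<Omega>"
    unfolding spop_pCons unfolding pop_pCons T_def[symmetric] a_def[symmetric] tmul_add_right tmul_add_left tmul_tmul
    by (simp only: mps_mult_commute[of f "mps_const c"]) (simp only: algebra_simps)
  with step show ?case by metis
qed

end

section \<open>Integer weights of the toric fields and coordinates in the lattice of weights\<close>

definition int_wt :: "('n::finite \<Rightarrow> int) \<Rightarrow> nat \<Rightarrow> nat \<Rightarrow> 'n list \<Rightarrow> 'n list \<Rightarrow> ('n \<Rightarrow> nat) \<Rightarrow> int" where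
  "int_wt c p q us ls \<alpha> =
     (\<Sum>j\<in>UNIV. c j * int (\<alpha> j)) - (\<Sum>a<p. c (us ! a)) + (\<Sum>b<q. c (ls ! b))"

lemma of_int_int_wt: "of_int (int_wt c p q us ls \<alpha>) = wt (\<lambda>j. of_int (c j)) p q us ls \<alpha>"
  by (simp add: int_wt_def wt_def)

lemma wt_sum:
  assumes "\<And>j. \<gamma> j = (\<Sum>k<\<tau>. \<rho> k * c k j)"
  shows "wt \<gamma> p q us ls \<alpha> = (\<Sum>k<\<tau>. \<rho> k * wt (c k) p q us ls \<alpha>)"
proof -
  have "(\<Sum>j\<in>UNIV. \<gamma> j * of_nat (\<alpha> j)) = (\<Sum>k<\<tau>. \<rho> k * (\<Sum>j\<in>UNIV. c k j * of_nat (\<alpha> j)))"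
    by (simp add: assms sum_distrib_left sum_distrib_right mult.assoc) (rule sum.swap)
  moreover have "(\<Sum>a<r. \<gamma> (xs ! a)) = (\<Sum>k<\<tau>. \<rho> k * (\<Sum>a<r. c k (xs ! a)))" for r xs
    by (simp add: assms sum_distrib_left) (rule sum.swap)
  ultimately show ?thesis
    by (simp add: wt_def ring_distribs sum.distrib sum_subtractf)
qed

text \<open>Defined on all complex numbers because it is also applied to the constant term of h,
  which may lie outside the lattice; the value there is 0 by convention.\<close>

definition lattice_coord :: "nat \<Rightarrow> (nat \<Rightarrow> complex) \<Rightarrow> nat \<Rightarrow> complex \<Rightarrow> complex" where
  "lattice_coord \<tau> \<rho> k w = (if \<exists>z. w = (\<Sum>l<\<tau>. \<rho> l * of_int (z l))
     then of_int ((SOME z. w = (\<Sum>l<\<tau>. \<rho> l * of_int (z l))) k) else 0)"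

text \<open>Two integer coordinate vectors of the same number differ by a rational relation among
  the \<rho> l, which incommensurability forces to be trivial. So the arbitrary choice in
  \<open>lattice_coord\<close> is harmless.\<close>

lemma lattice_coord_eq:
  assumes \<rho>: "incommensurable \<tau> \<rho>" and k: "k < \<tau>" and w: "w = (\<Sum>l<\<tau>. \<rho> l * of_int (z l))"
  shows "lattice_coord \<tau> \<rho> k w = of_int (z k)"
proof -
  define y where "y = (SOME z. w = (\<Sum>l<\<tau>. \<rho> l * of_int (z l)))"
  have y: "w = (\<Sum>l<\<tau>. \<rho> l * of_int (y l))"
    unfolding y_def by (rule someI[of _ z]) (rule w)
  define r where "r l = (of_int (y l - z l) :: rat)" for l
  have "(\<Sum>l<\<tau>. of_rat (r l) * \<rho> l) = (\<Sum>l<\<tau>. \<rho> l * of_int (y l)) - (\<Sum>l<\<tau>. \<rho> l * of_int (z l))"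
    by (simp add: r_def of_rat_diff algebra_simps sum_subtractf)
  then have "(\<Sum>l<\<tau>. of_rat (r l) * \<rho> l) = 0"
    using y w by simp
  then have "r k = 0"
    using \<rho> k unfolding incommensurable_def by blast
  then have "y k = z k"
    by (simp add: r_def)
  with w show ?thesis unfolding lattice_coord_def y_def by auto
qed

text \<open>Modulo order r, one polynomial P turns X on functions into Z_k and the twisted
  derivative into the Lie derivative along Z_k minus s; the identity for P(D) and P(X) then becomes
  the claim.\<close>

lemma (in pd_field) lie_Zfield_quotient:
  assumes f: "f \<noteq> 0"
    and h: "\<And>\<beta>. h \<beta> \<noteq> 0 \<Longrightarrow> dot \<gamma> \<beta> = 0"
    and eq: "tzero p q (tmul f (twisted_lie h p q \<Omega>) - tmul (vf_apply X f) \<Omega>)"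
    and \<gamma>: "\<And>j. \<gamma> j = (\<Sum>k<\<tau>. \<rho> k * of_int (a k j))"
    and \<rho>: "incommensurable \<tau> \<rho>" and k: "k < \<tau>"
  defines "s \<equiv> lattice_coord \<tau> \<rho> k (h (\<lambda>_. 0))"
  shows "tzero p q (tmul f (lie_tensor p q (Zfield a k) \<Omega> - tmul (mps_const s) \<Omega>)
    - tmul (vf_apply (Zfield a k) f) \<Omega>)"
  unfolding tzero_iff_tord
proof
  fix r
  define c where "c = h (\<lambda>_. 0)"
  define \<Gamma> where "\<Gamma> = {w. \<exists>z :: nat \<Rightarrow> int. w = (\<Sum>l<\<tau>. \<rho> l * of_int (z l))}"
  define \<eta> where "\<eta> = lattice_coord \<tau> \<rho> k"
  \<comment> \<open>Eigenvalues on functions are in \<Gamma> and should map to their k-th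
    coordinate; those on tensors are w - c with w in \<Gamma> and should map to the coordinate of w
    minus s. A clash occurs only if w - c is in \<Gamma>; then c is too, and additivity of \<eta>
    makes both values equal.\<close>
  define \<nu> where "\<nu> e = (if e \<in> \<Gamma> then \<eta> e else \<eta> (e + c) - s)" for e
  let ?wz = "wt (\<lambda>j. of_int (a k j))"
  have wt_\<gamma>: "wt \<gamma> p q us ls \<alpha> = (\<Sum>l<\<tau>. \<rho> l * of_int (int_wt (a l) p q us ls \<alpha>))" for p q us ls \<alpha>
    unfolding of_int_int_wt by (rule wt_sum) (rule \<gamma>)
  have wt_\<Gamma>: "wt \<gamma> p q us ls \<alpha> \<in> \<Gamma>" for p q us ls \<alpha>
    unfolding \<Gamma>_def using wt_\<gamma>[of p q us ls \<alpha>]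
    by (intro CollectI exI[of _ "\<lambda>l. int_wt (a l) p q us ls \<alpha>"])
  have \<eta>_wt: "\<eta> (wt \<gamma> p q us ls \<alpha>) = ?wz p q us ls \<alpha>" for p q us ls \<alpha>
    using lattice_coord_eq[OF \<rho> k wt_\<gamma>] by (simp add: \<eta>_def of_int_int_wt)
  have \<eta>_diff: "\<eta> (x - y) = \<eta> x - \<eta> y" and \<Gamma>_diff: "x - y \<in> \<Gamma>" if xy: "x \<in> \<Gamma>" "y \<in> \<Gamma>" for x y
  proof -
    obtain zx zy where z: "x = (\<Sum>l<\<tau>. \<rho> l * of_int (zx l))" "y = (\<Sum>l<\<tau>. \<rho> l * of_int (zy l))"
      using xy unfolding \<Gamma>_def by blast
    then have d: "x - y = (\<Sum>l<\<tau>. \<rho> l * of_int (zx l - zy l))"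
      by (simp add: ring_distribs sum_subtractf)
    then show "x - y \<in> \<Gamma>"
      unfolding \<Gamma>_def by (intro CollectI exI[of _ "\<lambda>l. zx l - zy l"])
    show "\<eta> (x - y) = \<eta> x - \<eta> y"
      using lattice_coord_eq[OF \<rho> k d] lattice_coord_eq[OF \<rho> k z(1)] lattice_coord_eq[OF \<rho> k z(2)]
      by (simp add: \<eta>_def)
  qed
  have s: "s = \<eta> c"
    by (simp add: s_def c_def \<eta>_def)
  have \<nu>_tensor: "\<nu> (wt \<gamma> p q us ls \<alpha> - c) = ?wz p q us ls \<alpha> - s" for us ls \<alpha>
  proof (cases "wt \<gamma> p q us ls \<alpha> - c \<in> \<Gamma>")
    case True
    have "\<eta> (wt \<gamma> p q us ls \<alpha> - (wt \<gamma> p q us ls \<alpha> - c)) = \<eta> (wt \<gamma> p q us ls \<alpha>) - \<eta> (wt \<gamma> p q us ls \<alpha> - c)"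
      by (rule \<eta>_diff[OF wt_\<Gamma> True])
    then show ?thesis using True by (simp add: \<nu>_def \<eta>_wt s)
  qed (simp add: \<nu>_def \<eta>_wt)
  obtain m where m: "\<And>n T us ls \<alpha> P \<nu>. n \<ge> m \<Longrightarrow> length us = p \<Longrightarrow> length ls = q \<Longrightarrow> sum \<alpha> UNIV < r \<Longrightarrow>
      [:- (wt \<gamma> p q us ls \<alpha> - c), 1:] ^ n dvd P - [:\<nu>:] \<Longrightarrow> pop h p q P T us ls \<alpha> = \<nu> * T us ls \<alpha>"
    using pop_diagonal[of h p q r, OF h] unfolding c_def by blast
  obtain m' where m': "\<And>n f \<alpha> P \<nu>. n \<ge> m' \<Longrightarrow> sum \<alpha> UNIV < r \<Longrightarrow> [:- dot \<gamma> \<alpha>, 1:] ^ n dvd P - [:\<nu>:] \<Longrightarrow>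
      spop P f \<alpha> = \<nu> * f \<alpha>"
    using spop_diagonal[of r] by blast
  \<comment> \<open>All eigenvalues below order r, on functions and on tensors; finitely many, so
    interpolation applies.\<close>
  define S where "S = dot \<gamma> ` {\<alpha>. sum \<alpha> UNIV < r}
    \<union> (\<lambda>(us, ls, \<alpha>). wt \<gamma> p q us ls \<alpha> - c) ` ({us. length us = p} \<times> {ls. length ls = q} \<times> {\<alpha>. sum \<alpha> UNIV < r})"
  have "finite {us :: 'n list. length us = l}" for l
    using finite_lists_length_eq[of "UNIV :: 'n set" l] by simp
  then have "finite S"
    unfolding S_def by (intro finite_UnI finite_dot_image finite_imageI finite_cartesian_product
        finite_multiindex_degree_less)
  then obtain P where P: "\<And>e. e \<in> S \<Longrightarrow> [:- e, 1:] ^ max m m' dvd P - [:\<nu> e:]"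
    using interpolation_poly_power[of S "max m m'" \<nu>] by blast
  have "pop h p q P \<Omega> us ls \<alpha> = (lie_tensor p q (Zfield a k) \<Omega> - tmul (mps_const s) \<Omega>) us ls \<alpha>"
    if "length us = p" "length ls = q" "sum \<alpha> UNIV < r" for us ls \<alpha>
  proof -
    have "wt \<gamma> p q us ls \<alpha> - c \<in> S"
      unfolding S_def using that by (intro UnI2 image_eqI[of _ _ "(us, ls, \<alpha>)"]) auto
    then have "pop h p q P \<Omega> us ls \<alpha> = \<nu> (wt \<gamma> p q us ls \<alpha> - c) * \<Omega> us ls \<alpha>"
      using that by (intro m[of "max m m'"] P) auto
    then show ?thesis
      by (simp add: \<nu>_tensor Zfield_def lie_tensor_diag tmul_const_apply left_diff_distrib)
  qed
  then have 1: "tord p q r (pop h p q P \<Omega> - (lie_tensor p q (Zfield a k) \<Omega> - tmul (mps_const s) \<Omega>))"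
    by (simp add: tord_def mord_def)
  have "spop P f \<alpha> = vf_apply (Zfield a k) f \<alpha>" if "sum \<alpha> UNIV < r" for \<alpha>
  proof -
    have dot: "dot c \<alpha> = wt c 0 0 [] [] \<alpha>" for c
      by (simp add: dot_def wt_def)
    have "spop P f \<alpha> = \<nu> (dot \<gamma> \<alpha>) * f \<alpha>"
      using that by (intro m'[of "max m m'"] P) (auto simp: S_def)
    moreover have "\<nu> (dot \<gamma> \<alpha>) = dot (\<lambda>j. of_int (a k j)) \<alpha>"
      using wt_\<Gamma>[of 0 0 "[]" "[]" \<alpha>] by (simp add: \<nu>_def dot \<eta>_wt)
    ultimately show ?thesis
      by (simp add: Zfield_def vf_apply_diag flip: dot_def)
  qed
  then have "mord r (spop P f - vf_apply (Zfield a k) f)"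
    by (simp add: mord_def)
  then have 2: "tord p q r (tmul (spop P f - vf_apply (Zfield a k) f) \<Omega>)"
    using tord_tmul[of r _ p q 0 \<Omega>] by simp
  \<comment> \<open>The first bracket vanishes on the relevant components by
    \<open>pop_quotient\<close>; the other two terms are the errors of replacing P(D) and P(X), both
    of order r.\<close>
  have "tmul f (lie_tensor p q (Zfield a k) \<Omega> - tmul (mps_const s) \<Omega>) - tmul (vf_apply (Zfield a k) f) \<Omega>
      = (tmul f (pop h p q P \<Omega>) - tmul (spop P f) \<Omega>)
        - tmul f (pop h p q P \<Omega> - (lie_tensor p q (Zfield a k) \<Omega> - tmul (mps_const s) \<Omega>))
        + tmul (spop P f - vf_apply (Zfield a k) f) \<Omega>"
    unfolding tmul_diff_right tmul_diff_left by (simp only: algebra_simps)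
  moreover have "tord p q r (tmul f (pop h p q P \<Omega>) - tmul (spop P f) \<Omega>)"
    using pop_quotient[OF f eq] by (simp only: tzero_iff_tord)
  moreover have "tord p q r (tmul f (pop h p q P \<Omega> - (lie_tensor p q (Zfield a k) \<Omega> - tmul (mps_const s) \<Omega>)))"
    using tord_tmul[of 0 f, OF _ 1] by simp
  ultimately show "tord p q r (tmul f (lie_tensor p q (Zfield a k) \<Omega> - tmul (mps_const s) \<Omega>)
      - tmul (vf_apply (Zfield a k) f) \<Omega>)"
    using 2 by (metis tord_add tord_diff)
qed

text \<open>The witness is s - Z_k(v): the constant s belongs to the modified tensor exp(v)
  \<Omega>, and undoing the modification subtracts the logarithmic derivative of exp(v) along
  Z_k.\<close>

lemma (in pd_field) lie_Zfield_quotient_semi_invariant: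
  assumes f: "f \<noteq> 0"
    and eq: "tzero p q (tmul f (lie_tensor p q X \<Omega>) - tmul (vf_apply X f) \<Omega> - tmul (f \<odot> g) \<Omega>)"
    and \<gamma>: "\<And>j. \<gamma> j = (\<Sum>k<\<tau>. \<rho> k * of_int (a k j))"
    and \<rho>: "incommensurable \<tau> \<rho>" and k: "k < \<tau>"
  shows "\<exists>gk. tzero p q (tmul f (lie_tensor p q (Zfield a k) \<Omega>) - tmul (vf_apply (Zfield a k) f) \<Omega>
    - tmul (f \<odot> gk) \<Omega>)"
proof -
  define h where "h = (\<lambda>\<alpha>. if dot \<gamma> \<alpha> = 0 then g \<alpha> else 0)"
  have h: "h \<beta> \<noteq> 0 \<Longrightarrow> dot \<gamma> \<beta> = 0" for \<beta>
    by (auto simp: h_def split: if_splits)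
  have "(h - g) \<alpha> \<noteq> 0 \<Longrightarrow> dot \<gamma> \<alpha> \<noteq> 0" for \<alpha>
    by (auto simp: h_def)
  from homological_equation[OF this] obtain v where v: "v (\<lambda>_. 0) = 0" "vf_apply X v = h - g"
    by blast
  obtain u where u: "u (\<lambda>_. 0) = 1" "\<And>k. mps_deriv k u = u \<odot> mps_deriv k v"
    using mps_exp_exists[of v] v(1) by blast
  have "u \<noteq> 0" using u(1) by auto
  have Vu: "vf_apply V u = u \<odot> vf_apply V v" for V
    by (simp only: vf_apply_alt u(2) mps_mult_sum_right mps_mult_left_commute)
  define \<Omega>' where "\<Omega>' = tmul u \<Omega>"
  let ?Z = "Zfield a k"
  define s where "s = lattice_coord \<tau> \<rho> k (h (\<lambda>_. 0))"
  \<comment> \<open>The factor u has logarithmic derivative h - g along X, which changes the factor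
    g into its weight-zero part h.\<close>
  have "tmul f (twisted_lie h p q \<Omega>') - tmul (vf_apply X f) \<Omega>'
      = tmul u (tmul f (lie_tensor p q X \<Omega>) - tmul (vf_apply X f) \<Omega> - tmul (f \<odot> g) \<Omega>)"
    unfolding \<Omega>'_def twisted_lie_def lie_tensor_tmul Vu v(2) mps_mult_diff_right tmul_diff_right
      tmul_add_right tmul_diff_left tmul_tmul
    by (simp only: mps_mult_ac) (simp only: algebra_simps)
  then have "tzero p q (tmul f (twisted_lie h p q \<Omega>') - tmul (vf_apply X f) \<Omega>')"
    using tzero_tmul[OF eq, of u] by metis
  from lie_Zfield_quotient[OF f h this \<gamma> \<rho> k]
  have 1: "tzero p q (tmul f (lie_tensor p q ?Z \<Omega>' - tmul (mps_const s) \<Omega>') - tmul (vf_apply ?Z f) \<Omega>')"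
    unfolding s_def by blast
  have "tmul f (lie_tensor p q ?Z \<Omega>' - tmul (mps_const s) \<Omega>') - tmul (vf_apply ?Z f) \<Omega>'
     = tmul u (tmul f (lie_tensor p q ?Z \<Omega>) - tmul (vf_apply ?Z f) \<Omega>
         - tmul (f \<odot> (mps_const s - vf_apply ?Z v)) \<Omega>)"
    unfolding \<Omega>'_def lie_tensor_tmul Vu mps_mult_diff_right tmul_diff_right
      tmul_add_right tmul_diff_left tmul_tmul
    by (simp only: mps_mult_ac) (simp only: algebra_simps)
  with 1 \<open>u \<noteq> 0\<close> have "tzero p q (tmul f (lie_tensor p q ?Z \<Omega>) - tmul (vf_apply ?Z f) \<Omega>
         - tmul (f \<odot> (mps_const s - vf_apply ?Z v)) \<Omega>)"
    by (metis tzero_tmul_cancel)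
  then show ?thesis by blast
qed

section \<open>Translation from rational tensor fields and the normal form hypotheses\<close>

lemma mps_sub_eq: "mps_sub f g = f - g"
  by (rule ext) (simp add: mps_sub_def)

lemma mps_zero_eq: "mps_zero = 0"
  by (rule ext) (simp add: mps_zero_def)

lemma rat_eq_lie_zero_iff:
  "rat_eq p q (rat_lie p q V (\<Omega>, f)) rat_zero \<longleftrightarrow>
     tzero p q (tmul f (lie_tensor p q V \<Omega>) - tmul (vf_apply V f) \<Omega>)"
  unfolding rat_eq_def rat_lie_def rat_zero_def tensor_eq_def tzero_def
  by (simp add: mps_sub_eq mps_zero_eq tmul_apply)

text \<open>The quotient rule has denominator f^2 and the right-hand side denominator f, so
  cross-multiplication carries one surplus factor f, which is cancelled.\<close>

lemma rat_eq_lie_smul_iff: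
  assumes "f \<noteq> 0"
  shows "rat_eq p q (rat_lie p q V (\<Omega>, f)) (rat_smul g (\<Omega>, f)) \<longleftrightarrow>
     tzero p q (tmul f (lie_tensor p q V \<Omega>) - tmul (vf_apply V f) \<Omega> - tmul (f \<odot> g) \<Omega>)"
  unfolding rat_eq_def rat_lie_def rat_smul_def tensor_eq_def tzero_def
  by (simp add: mps_sub_eq tmul_apply mps_mult_assoc mps_mult_left_cancel assms)

text \<open>The coefficient at \<alpha> of the i-th component of the bracket is
  \<open>(dot \<gamma> \<alpha> - \<gamma> i) * X i \<alpha>\<close>, which gives the resonance
  condition. For the order condition, an index of degree below 2 is zero or a unit index, where X
  vanishes or is given by its linear part.\<close>

lemma pd_fieldI:
  assumes X0: "vanishes_at_0 X" and ss: "semisimple_part_is_diag X \<gamma>" and PD: "PD_normal_form X \<gamma>"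
  shows "\<exists>N. pd_field X \<gamma> N"
proof -
  obtain N where N: "linear_part X = (\<lambda>i j. diag_mat \<gamma> i j + N i j)" "mat_nilpotent N"
    using ss by (auto simp: semisimple_part_is_diag_def)
  have "pd_field X \<gamma> N"
  proof
    show "mat_nilpotent N" by (rule N(2))
  next
    fix i \<alpha> assume nz: "X i \<alpha> \<noteq> 0"
    have "lie_bracket (diag_vf \<gamma>) X i \<alpha> = 0"
      using PD by (simp add: PD_normal_form_def mps_zero_def)
    moreover have "vf_apply X (diag_vf \<gamma> i) = mps_const (\<gamma> i) \<odot> X i"
    proof -
      have "vf_apply X (diag_vf \<gamma> i) = (\<Sum>k\<in>UNIV. if k = i then mps_const (\<gamma> i) \<odot> X i else 0)"
        unfolding vf_apply_alt mps_deriv_diag by (rule sum.cong) (auto simp: mps_mult_commute)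
      then show ?thesis by simp
    qed
    ultimately have "(dot \<gamma> \<alpha> - \<gamma> i) * X i \<alpha> = 0"
      by (simp add: lie_bracket_def mps_sub_def vf_apply_diag mps_mult_const_left dot_def left_diff_distrib)
    with nz show "dot \<gamma> \<alpha> = \<gamma> i" by simp
  next
    fix i
    show "mord 2 (X i - diag_vf \<gamma> i - lin_vf N i)"
      unfolding mord_def
    proof (intro allI impI)
      fix \<alpha> :: "'a \<Rightarrow> nat" assume "sum \<alpha> UNIV < 2"
      have lin: "lin_vf N i \<alpha> = (\<Sum>l\<in>UNIV. N i l * mps_var l \<alpha>)"
        by (simp add: lin_vf_def sum_fun_apply mps_mult_const_left)
      show "(X i - diag_vf \<gamma> i - lin_vf N i) \<alpha> = 0"
      proof (cases "\<alpha> = (\<lambda>_. 0)")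
        case True
        have "mps_var l \<alpha> = 0" for l
          by (simp add: True mps_var_def fun_eq_iff)
        then show ?thesis
          using X0 by (simp add: lin diag_vf_def) (simp add: True vanishes_at_0_def)
      next
        case False
        then obtain j where j: "\<alpha> j \<noteq> 0" by (auto simp: fun_eq_iff)
        have "sum \<alpha> UNIV = \<alpha> j + sum \<alpha> (UNIV - {j})" by (rule sum.remove) auto
        with j \<open>sum \<alpha> UNIV < 2\<close> have "\<alpha> j = 1" "sum \<alpha> (UNIV - {j}) = 0" by linarith+
        moreover from this have "\<forall>l\<in>UNIV - {j}. \<alpha> l = 0" by (subst (asm) sum_eq_0_iff) auto
        ultimately have \<alpha>: "\<alpha> = unit_idx j" by (simp add: fun_eq_iff)
        have var: "mps_var l \<alpha> = (if l = j then 1 else 0)" for l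
          by (simp add: \<alpha> mps_var_def fun_eq_iff) metis
        have "X i \<alpha> = diag_mat \<gamma> i j + N i j"
          using fun_cong[OF fun_cong[OF N(1), of i], of j] by (simp add: linear_part_def \<alpha>)
        then show ?thesis
          by (simp add: lin diag_vf_def var diag_mat_def if_distrib cong: if_cong)
      qed
    qed
  qed
  then show ?thesis by (intro exI[of _ N])
qed

theorem theorem2p3:
  fixes X :: "'n::finite vf"
    and \<gamma> :: "'n \<Rightarrow> complex"
    and \<tau> :: nat and \<rho> :: "nat \<Rightarrow> complex" and a :: "nat \<Rightarrow> 'n \<Rightarrow> int"
    and p q :: nat and \<Lambda> :: "'n rtensor"
  assumes "vanishes_at_0 X"
    and "semisimple_part_is_diag X \<gamma>"
    and "PD_normal_form X \<gamma>"
    and "\<forall>j. \<gamma> j = (\<Sum>k<\<tau>. \<rho> k * of_int (a k j))"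
    and "incommensurable \<tau> \<rho>"
    and "rat_nontrivial \<Lambda>"
  shows "(rat_eq p q (rat_lie p q X \<Lambda>) rat_zero \<longrightarrow>
            (\<forall>k<\<tau>. rat_eq p q (rat_lie p q (Zfield a k) \<Lambda>) rat_zero))
       \<and> (\<forall>g. rat_eq p q (rat_lie p q X \<Lambda>) (rat_smul g \<Lambda>) \<longrightarrow>
            (\<forall>k<\<tau>. \<exists>gk. rat_eq p q (rat_lie p q (Zfield a k) \<Lambda>) (rat_smul gk \<Lambda>)))"
proof -
  obtain N where "pd_field X \<gamma> N"
    using pd_fieldI[OF assms(1-3)] by blast
  then interpret pd_field X \<gamma> N .
  obtain \<Omega> f where \<Lambda>: "\<Lambda> = (\<Omega>, f)" by (cases \<Lambda>)
  have f: "f \<noteq> 0" using assms(6) by (simp add: \<Lambda> rat_nontrivial_def mps_zero_eq)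
  have \<gamma>: "\<gamma> j = (\<Sum>k<\<tau>. \<rho> k * of_int (a k j))" for j using assms(4) by blast
  have "rat_eq p q (rat_lie p q (Zfield a k) \<Lambda>) rat_zero"
    if "rat_eq p q (rat_lie p q X \<Lambda>) rat_zero" "k < \<tau>" for k
  proof -
    have tw: "twisted_lie 0 p q \<Omega> = lie_tensor p q X \<Omega>"
      by (simp add: twisted_lie_def)
    \<comment> \<open>Part (i) is the case h = 0: the lattice coordinate of 0 is 0, so no constant
      survives.\<close>
    have "lattice_coord \<tau> \<rho> k 0 = 0"
      using lattice_coord_eq[OF assms(5) that(2), of 0 "\<lambda>_. 0"] by simp
    moreover have "tzero p q (tmul f (twisted_lie 0 p q \<Omega>) - tmul (vf_apply X f) \<Omega>)"
      using that(1) unfolding \<Lambda> rat_eq_lie_zero_iff tw .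
    ultimately show ?thesis
      using lie_Zfield_quotient[OF f _ _ \<gamma> assms(5) that(2), of 0 p q \<Omega>]
      unfolding \<Lambda> rat_eq_lie_zero_iff by simp
  qed
  moreover have "\<exists>gk. rat_eq p q (rat_lie p q (Zfield a k) \<Lambda>) (rat_smul gk \<Lambda>)"
    if "rat_eq p q (rat_lie p q X \<Lambda>) (rat_smul g \<Lambda>)" "k < \<tau>" for g k
    using that(1) lie_Zfield_quotient_semi_invariant[OF f _ \<gamma> assms(5) that(2)]
    unfolding \<Lambda> rat_eq_lie_smul_iff[OF f] by blast
  ultimately show ?thesis by blast
qed

end
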